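(* Let $d\ge1$, $m>0$, $\varkappa>0$, let $E$ be one of the spaces $C_{ub}(\mathbb{R}^d)$, $C_b(\mathbb{R}^d)$, $L^\infty(\mathbb{R}^d)$, and let $0\le a\in L^1(\mathbb{R}^d)$ with $\int_{\mathbb{R}^d}a(x)\,dx=1$. Let $G:E\to E$ be such that $Gv\ge0$ for all $0\le v\in E$ and, for some $\kappa>0$, $$\|Gv-Gw\|_E\le e^{\kappa r}\|v-w\|_E,\qquad v,w\in E_r^+,\ r>0 .$$ Then, for any $T>0$ and $0\le u_0\in E$, there exists a unique nonnegative classical solution $u$ on $[0,T]$ to $$\frac{\partial u}{\partial t}(x,t)=\varkappa(a*u)(x,t)-m\,u(x,t)-u(x,t)(Gu)(x,t),\qquad u(x,0)=u_0(x).$$ In particular, $u\in C([0,\infty)\to E)\cap C^1((0,\infty)\to E)$.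
   Context: $C_{ub}(\mathbb{R}^d)$ and $C_b(\mathbb{R}^d)$ are the spaces of bounded uniformly continuous, respectively bounded continuous, real functions with the sup-norm; $L^\infty(\mathbb{R}^d)$ has the esssup-norm. Inequalities between elements of $E$ are pointwise (a.e. if $E=L^\infty$). For $r>0$, $E_r^+:=\{v\in E:0\le v\le r\}$. $(a*u)(x,t)=\int_{\mathbb{R}^d}a(x-y)u(y,t)\,dy$; $(Gu)(x,t)$ means $(Gu(\cdot,t))(x)$. A classical solution on $[0,T]$ is a function $u\in C([0,T]\to E)\cap C^1((0,T]\to E)$ which satisfies the equation for $t\in(0,T]$ and $u(\cdot,0)=u_0$ in $E$. The last assertion means that the solutions on the intervals $[0,T]$, $T>0$, define a classical solution on $[0,\infty)$. *)

theory Defs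
  imports "HOL-Analysis.Analysis" "HOL-Probability.Essential_Supremum"
begin

text \<open>
  Elements of the three spaces are represented by functions. For \<open>Linf\<close> these are representatives
  of classes modulo equality almost everywhere; accordingly, equality of elements is always
  \<open>eq_in E\<close>, and an operator on the space has to respect \<open>eq_in E\<close>.
  For \<open>Cub\<close> and \<open>Cb\<close>, \<open>eq_in E\<close> is plain equality of functions.
\<close>

datatype fspace = Cub | Cb | Linf

fun elements :: "fspace \<Rightarrow> ('a::euclidean_space \<Rightarrow> real) set" where
  "elements Cub = {f \<in> bcontfun. uniformly_continuous_on UNIV f}"
| "elements Cb = bcontfun"
| "elements Linf = {f \<in> borel_measurable lebesgue. \<exists>C. AE x in lebesgue. \<bar>f x\<bar> \<le> C}"

fun norm_in :: "fspace \<Rightarrow> ('a::euclidean_space \<Rightarrow> real) \<Rightarrow> real" where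
  "norm_in Cub f = (SUP x. \<bar>f x\<bar>)"
| "norm_in Cb f = (SUP x. \<bar>f x\<bar>)"
| "norm_in Linf f = real_of_ereal (esssup lebesgue (\<lambda>x. ereal \<bar>f x\<bar>))"

fun holds_in :: "fspace \<Rightarrow> ('a::euclidean_space \<Rightarrow> bool) \<Rightarrow> bool" where
  "holds_in Cub P \<longleftrightarrow> (\<forall>x. P x)"
| "holds_in Cb P \<longleftrightarrow> (\<forall>x. P x)"
| "holds_in Linf P \<longleftrightarrow> (AE x in lebesgue. P x)"

definition eq_in :: "fspace \<Rightarrow> ('a::euclidean_space \<Rightarrow> real) \<Rightarrow> ('a \<Rightarrow> real) \<Rightarrow> bool" where
  "eq_in E v w \<longleftrightarrow> holds_in E (\<lambda>x. v x = w x)"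

definition le_in :: "fspace \<Rightarrow> ('a::euclidean_space \<Rightarrow> real) \<Rightarrow> ('a \<Rightarrow> real) \<Rightarrow> bool" where
  "le_in E v w \<longleftrightarrow> holds_in E (\<lambda>x. v x \<le> w x)"

text \<open>The order interval $E_r^+$.\<close>

definition tube :: "fspace \<Rightarrow> real \<Rightarrow> ('a::euclidean_space \<Rightarrow> real) set" where
  "tube E r = {v \<in> elements E. le_in E (\<lambda>x. 0) v \<and> le_in E v (\<lambda>x. r)}"

definition convolution :: "('a::euclidean_space \<Rightarrow> real) \<Rightarrow> ('a \<Rightarrow> real) \<Rightarrow> 'a \<Rightarrow> real" where
  "convolution a v x = (LINT y|lebesgue. a (x - y) * v y)"

text \<open>
  Continuity and differentiability of maps from a set of times into a space, with respect to its
  norm. The time variable comes first: \<open>u t\<close> is the spatial function $u(\cdot,t)$.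
\<close>

definition cont_in :: "fspace \<Rightarrow> real set \<Rightarrow> (real \<Rightarrow> 'a::euclidean_space \<Rightarrow> real) \<Rightarrow> bool" where
  "cont_in E J u \<longleftrightarrow>
     (\<forall>t\<in>J. u t \<in> elements E) \<and>
     (\<forall>t\<in>J. ((\<lambda>s. norm_in E (\<lambda>x. u s x - u t x)) \<longlongrightarrow> 0) (at t within J))"

definition has_deriv_in ::
  "fspace \<Rightarrow> real set \<Rightarrow> (real \<Rightarrow> 'a::euclidean_space \<Rightarrow> real) \<Rightarrow> ('a \<Rightarrow> real) \<Rightarrow> real \<Rightarrow> bool" where
  "has_deriv_in E J u w t \<longleftrightarrow>
     ((\<lambda>s. norm_in E (\<lambda>x. (u s x - u t x) / (s - t) - w x)) \<longlongrightarrow> 0) (at t within J)"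

text \<open>\<open>u\<close> belongs to $C^1(J\to E)$ and has the derivative \<open>u'\<close>.\<close>

definition C1_in ::
  "fspace \<Rightarrow> real set \<Rightarrow> (real \<Rightarrow> 'a::euclidean_space \<Rightarrow> real) \<Rightarrow> (real \<Rightarrow> 'a \<Rightarrow> real) \<Rightarrow> bool" where
  "C1_in E J u u' \<longleftrightarrow>
     cont_in E J u \<and> cont_in E J u' \<and> (\<forall>t\<in>J. has_deriv_in E J u (u' t) t)"

text \<open>Here \<open>I\<close> is a time interval containing its left endpoint 0.\<close>

definition classical_solution ::
  "fspace \<Rightarrow> real \<Rightarrow> real \<Rightarrow> ('a::euclidean_space \<Rightarrow> real) \<Rightarrow> (('a \<Rightarrow> real) \<Rightarrow> ('a \<Rightarrow> real)) \<Rightarrow>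
   ('a \<Rightarrow> real) \<Rightarrow> real set \<Rightarrow> (real \<Rightarrow> 'a \<Rightarrow> real) \<Rightarrow> bool" where
  "classical_solution E varkappa m a G u0 I u \<longleftrightarrow>
     cont_in E I u \<and>
     (\<exists>u'. C1_in E (I - {0}) u u' \<and>
        (\<forall>t\<in>I - {0}. eq_in E (u' t)
           (\<lambda>x. varkappa * convolution a (u t) x - m * u t x - u t x * G (u t) x))) \<and>
     eq_in E (u 0) u0"

definition nonneg_classical_solution ::
  "fspace \<Rightarrow> real \<Rightarrow> real \<Rightarrow> ('a::euclidean_space \<Rightarrow> real) \<Rightarrow> (('a \<Rightarrow> real) \<Rightarrow> ('a \<Rightarrow> real)) \<Rightarrow>
   ('a \<Rightarrow> real) \<Rightarrow> real set \<Rightarrow> (real \<Rightarrow> 'a \<Rightarrow> real) \<Rightarrow> bool" where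
  "nonneg_classical_solution E varkappa m a G u0 I u \<longleftrightarrow>
     classical_solution E varkappa m a G u0 I u \<and> (\<forall>t\<in>I. le_in E (\<lambda>x. 0) (u t))"

end

theory Submission
  imports Defs
begin

text \<open>
  All three spaces embed isometrically in the Banach algebra of classes of essentially bounded
  functions: a continuous function that satisfies a closed condition almost everywhere satisfies
  it everywhere, so that the sup-norm is the essential supremum. The images are closed
  subspaces, and closed under multiplication and under convolution with \<open>a\<close>. The equation thus becomes
  an ordinary differential equation \<open>U' = \<nu> A U - m U - U * G U\<close> in a Banach algebra, where \<open>A\<close>
  is the convolution and \<open>\<nu>\<close> stands for \<open>varkappa\<close>. Nonnegativity is
  expressed by the norm: \<open>0 \<le> V \<le> r\<close> holds if and only if \<open>V\<close> lies in the ball of radius \<open>r/2\<close> about the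
  constant \<open>r/2\<close>. Such balls are preserved by \<open>A\<close>, because \<open>A 1 = 1\<close> and \<open>A\<close> is a contraction, and they
  are compatible with sums, products and integrals.

  Existence on \<open>[0, T]\<close> (\<open>solution_exists\<close>): if \<open>0 \<le> u0 \<le> c\<close>, a nonnegative solution should satisfy
  \<open>U t \<le> R\<close> with \<open>R = c exp (\<nu> T)\<close>. On the order interval from 0 to \<open>R\<close> the operator \<open>G\<close> is Lipschitz,
  nonnegative, and at most some constant \<open>M\<close>. For \<open>V t = exp ((m + M) t) U t\<close> the equation
  reads \<open>V' = \<nu> A V + V * (M - G U)\<close>, with a right-hand side between 0 and \<open>(\<nu> + M) \<rho>\<close> as long
  as \<open>0 \<le> V \<le> \<rho>\<close>. With \<open>\<rho> t = c exp ((\<nu> + M) t)\<close> the Picard operator therefore maps the curves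
  with \<open>0 \<le> V t \<le> \<rho> t\<close> to themselves, and its iterates converge uniformly on all of \<open>[0, T]\<close>
  (\<open>picard_lindelof_invariant\<close>). This gives existence, nonnegativity and the a priori bound together.

  Uniqueness (\<open>solution_unique\<close>): two nonnegative solutions on \<open>[0, T]\<close> are bounded by continuity, so both
  stay in one order interval, where the right-hand side is Lipschitz; Gronwall's lemma applies.
  By uniqueness the solutions on the intervals \<open>[0, T]\<close> fit together to a solution on \<open>[0, \<infinity>)\<close>.
\<close>

section \<open>The Banach algebra of essentially bounded functions\<close>

lemma elements_Linf_iff:
  "f \<in> elements Linf \<longleftrightarrow> f \<in> borel_measurable lebesgue \<and> (\<exists>C. AE x in lebesgue. \<bar>f x\<bar> \<le> C)"
  by simp

lemma Linf_measurable: "f \<in> elements Linf \<Longrightarrow> f \<in> borel_measurable lebesgue"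
  by simp

lemma Linf_boundE:
  assumes "f \<in> elements Linf"
  obtains C where "0 \<le> C" "AE x in lebesgue. \<bar>f x\<bar> \<le> C"
proof -
  from assms obtain C where "AE x in lebesgue. \<bar>f x\<bar> \<le> C" by auto
  then have "AE x in lebesgue. \<bar>f x\<bar> \<le> max 0 C" by eventually_elim auto
  then show ?thesis by (intro that[of "max 0 C"]) auto
qed

lemma Linf_const: "(\<lambda>x::'a::euclidean_space. c) \<in> elements Linf"
  by auto

lemma Linf_add:
  assumes "f \<in> elements Linf" "g \<in> elements Linf"
  shows "(\<lambda>x. f x + g x) \<in> elements Linf"
proof -
  obtain C D where "AE x in lebesgue. \<bar>f x\<bar> \<le> C" "AE x in lebesgue. \<bar>g x\<bar> \<le> D"
    using assms by auto
  then have "AE x in lebesgue. \<bar>f x + g x\<bar> \<le> C + D" by eventually_elim auto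
  then show ?thesis using assms by auto
qed

lemma Linf_mult:
  assumes "f \<in> elements Linf" "g \<in> elements Linf"
  shows "(\<lambda>x. f x * g x) \<in> elements Linf"
proof -
  obtain C D where "0 \<le> C" "AE x in lebesgue. \<bar>f x\<bar> \<le> C" "0 \<le> D" "AE x in lebesgue. \<bar>g x\<bar> \<le> D"
    using assms Linf_boundE by metis
  then have "AE x in lebesgue. \<bar>f x * g x\<bar> \<le> C * D"
    by (auto simp: abs_mult elim!: eventually_elim2 intro!: mult_mono)
  then show ?thesis using assms by auto
qed

lemma Linf_cmult: "f \<in> elements Linf \<Longrightarrow> (\<lambda>x. c * f x) \<in> elements Linf"
  using Linf_mult[OF Linf_const[of c]] by blast

lemma Linf_uminus: "f \<in> elements Linf \<Longrightarrow> (\<lambda>x. - f x) \<in> elements Linf"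
  using Linf_cmult[of f "-1"] by auto

lemma Linf_diff:
  "f \<in> elements Linf \<Longrightarrow> g \<in> elements Linf \<Longrightarrow> (\<lambda>x. f x - g x) \<in> elements Linf"
  using Linf_add[OF _ Linf_uminus, of f g] by auto

lemma emeasure_lebesgue_UNIV_neq_0: "emeasure lebesgue (space (lebesgue :: 'a::euclidean_space measure)) \<noteq> 0"
  by simp

lemma AE_lebesgue_const: "(AE x in (lebesgue :: 'a::euclidean_space measure). P) \<longleftrightarrow> P"
proof -
  have "ae_filter (lebesgue :: 'a measure) \<noteq> bot"
    unfolding ae_filter_eq_bot_iff by (rule emeasure_lebesgue_UNIV_neq_0)
  then show ?thesis by (cases P) (auto simp: trivial_limit_def)
qed

text \<open>
  Lebesgue measure is not zero, so that the essential supremum of a nonnegative function is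
  nonnegative, and finite for an essentially bounded one. Hence the conversion to \<open>real\<close> in
  \<open>norm_in\<close> loses nothing.
\<close>

lemma norm_Linf_le_iff:
  fixes f :: "'a::euclidean_space \<Rightarrow> real"
  assumes f: "f \<in> elements Linf"
  shows "norm_in Linf f \<le> C \<longleftrightarrow> (AE x in lebesgue. \<bar>f x\<bar> \<le> C)"
proof -
  have meas: "(\<lambda>x. ereal \<bar>f x\<bar>) \<in> borel_measurable lebesgue" using Linf_measurable[OF f] by measurable
  let ?N = "esssup lebesgue (\<lambda>x. ereal \<bar>f x\<bar>)"
  obtain D where "AE x in lebesgue. \<bar>f x\<bar> \<le> D" using f by auto
  then have "?N \<le> ereal D" by (intro esssup_I meas) (auto elim: eventually_mono)
  have "ereal 0 = esssup lebesgue (\<lambda>x::'a. ereal 0)"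
    using emeasure_lebesgue_UNIV_neq_0 esssup_const by metis
  also have "\<dots> \<le> ?N" by (intro esssup_AE_mono) auto
  finally have "ereal 0 \<le> ?N" .
  with \<open>?N \<le> ereal D\<close> have N: "?N = ereal (norm_in Linf f)"
    by (cases ?N) (auto simp: zero_ereal_def)
  show ?thesis
  proof
    assume "norm_in Linf f \<le> C"
    have "AE x in lebesgue. ereal \<bar>f x\<bar> \<le> ?N" by (rule esssup_AE)
    then show "AE x in lebesgue. \<bar>f x\<bar> \<le> C"
      unfolding N by eventually_elim (use \<open>norm_in Linf f \<le> C\<close> in simp)
  next
    assume "AE x in lebesgue. \<bar>f x\<bar> \<le> C"
    then have "?N \<le> ereal C" by (intro esssup_I meas) (auto elim: eventually_mono)
    then show "norm_in Linf f \<le> C" unfolding N by simp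
  qed
qed

lemma AE_norm_Linf: "f \<in> elements Linf \<Longrightarrow> AE x in lebesgue. \<bar>f x\<bar> \<le> norm_in Linf f"
  using norm_Linf_le_iff[of f "norm_in Linf f"] by simp

lemma norm_Linf_nonneg:
  fixes f :: "'a::euclidean_space \<Rightarrow> real"
  assumes "f \<in> elements Linf"
  shows "0 \<le> norm_in Linf f"
proof -
  have "AE x in (lebesgue :: 'a measure). 0 \<le> norm_in Linf f"
    using AE_norm_Linf[OF assms] by eventually_elim auto
  then show ?thesis unfolding AE_lebesgue_const .
qed

lemma norm_Linf_cong:
  assumes "f \<in> elements Linf" "g \<in> elements Linf" "AE x in lebesgue. f x = g x"
  shows "norm_in Linf f = norm_in Linf g"
proof (rule antisym)
  show "norm_in Linf f \<le> norm_in Linf g"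
    using AE_norm_Linf[OF assms(2)] assms(3) unfolding norm_Linf_le_iff[OF assms(1)]
    by eventually_elim auto
  show "norm_in Linf g \<le> norm_in Linf f"
    using AE_norm_Linf[OF assms(1)] assms(3) unfolding norm_Linf_le_iff[OF assms(2)]
    by eventually_elim auto
qed

text \<open>
  The type of classes of essentially bounded functions modulo equality almost everywhere.
  The class of \<open>f\<close> is \<open>cls f\<close>; it is meaningful only if \<open>f \<in> elements Linf\<close>.
\<close>

quotient_type (overloaded) 'a linf = "'a::euclidean_space \<Rightarrow> real" / partial:
  "\<lambda>f g. f \<in> elements Linf \<and> g \<in> elements Linf \<and> (AE x in lebesgue. f x = g x)"
  morphisms rep_linf cls
proof (rule part_equivpI)
  show "\<exists>f. f \<in> elements Linf \<and> f \<in> elements Linf \<and> (AE x in lebesgue. f x = f x)"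
    by (rule exI[of _ "\<lambda>_. 0"]) auto
qed (auto simp: symp_def transp_def elim: eventually_elim2 simp del: elements.simps)

declare elements.simps [simp del] norm_in.simps(3) [simp del]

instantiation linf :: (euclidean_space) real_vector
begin

lift_definition zero_linf :: "'a linf" is "\<lambda>_. 0" by (simp add: Linf_const)
lift_definition plus_linf :: "'a linf \<Rightarrow> 'a linf \<Rightarrow> 'a linf" is "\<lambda>f g x. f x + g x"
  by (auto simp: Linf_add elim: eventually_elim2)
lift_definition minus_linf :: "'a linf \<Rightarrow> 'a linf \<Rightarrow> 'a linf" is "\<lambda>f g x. f x - g x"
  by (auto simp: Linf_diff elim: eventually_elim2)
lift_definition uminus_linf :: "'a linf \<Rightarrow> 'a linf" is "\<lambda>f x. - f x"
  by (auto simp: Linf_uminus)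
lift_definition scaleR_linf :: "real \<Rightarrow> 'a linf \<Rightarrow> 'a linf" is "\<lambda>c f x. c * f x"
  by (auto simp: Linf_cmult elim: eventually_mono)
instance
proof
  fix F G H :: "'a linf" and c d :: real
  note simps = Linf_add Linf_mult Linf_diff Linf_cmult Linf_uminus Linf_const
  show "F + G + H = F + (G + H)" by transfer (simp add: simps add.assoc)
  show "F + G = G + F" by transfer (simp add: simps add.commute)
  show "0 + F = F" by transfer (simp add: simps)
  show "- F + F = 0" by transfer (simp add: simps)
  show "F - G = F + - G" by transfer (simp add: simps)
  show "c *\<^sub>R (F + G) = c *\<^sub>R F + c *\<^sub>R G" by transfer (simp add: simps algebra_simps)
  show "(c + d) *\<^sub>R F = c *\<^sub>R F + d *\<^sub>R F" by transfer (simp add: simps algebra_simps)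
  show "c *\<^sub>R d *\<^sub>R F = (c * d) *\<^sub>R F" by transfer (simp add: simps algebra_simps)
  show "1 *\<^sub>R F = F" by transfer (simp add: simps)
qed

end

instantiation linf :: (euclidean_space) real_normed_algebra_1
begin

lift_definition one_linf :: "'a linf" is "\<lambda>_. 1" by (simp add: Linf_const)
lift_definition times_linf :: "'a linf \<Rightarrow> 'a linf \<Rightarrow> 'a linf" is "\<lambda>f g x. f x * g x"
  by (auto simp: Linf_mult elim: eventually_elim2)
lift_definition norm_linf :: "'a linf \<Rightarrow> real" is "norm_in Linf"
  by (auto intro: norm_Linf_cong)
definition "dist_linf (F :: 'a linf) G = norm (F - G)"
definition "sgn_linf (F :: 'a linf) = F /\<^sub>R norm F"
definition [code del]:
  "(uniformity :: ('a linf \<times> 'a linf) filter) = (INF e\<in>{0<..}. principal {(x, y). dist x y < e})"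
definition [code del]:
  "open (U :: 'a linf set) \<longleftrightarrow> (\<forall>x\<in>U. eventually (\<lambda>(x', y). x' = x \<longrightarrow> y \<in> U) uniformity)"

instance
proof
  fix F G H :: "'a linf" and c :: real and U :: "'a linf set"
  note simps = Linf_add Linf_mult Linf_diff Linf_cmult Linf_uminus Linf_const
  show "dist F G = norm (F - G)" by (rule dist_linf_def)
  show "sgn F = F /\<^sub>R norm F" by (rule sgn_linf_def)
  show "(uniformity :: ('a linf \<times> 'a linf) filter) = (INF e\<in>{0<..}. principal {(x, y). dist x y < e})"
    by (rule uniformity_linf_def)
  show "open U = (\<forall>x\<in>U. eventually (\<lambda>(x', y). x' = x \<longrightarrow> y \<in> U) uniformity)"
    by (rule open_linf_def)
  show "F * G * H = F * (G * H)" by transfer (simp add: simps mult.assoc)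
  show "(F + G) * H = F * H + G * H" by transfer (simp add: simps algebra_simps)
  show "F * (G + H) = F * G + F * H" by transfer (simp add: simps algebra_simps)
  show "c *\<^sub>R F * G = c *\<^sub>R (F * G)" by transfer (simp add: simps algebra_simps)
  show "F * c *\<^sub>R G = c *\<^sub>R (F * G)" by transfer (simp add: simps algebra_simps)
  show "1 * F = F" by transfer (simp add: simps)
  show "F * 1 = F" by transfer (simp add: simps)
  show "(0 :: 'a linf) \<noteq> 1" by transfer (simp add: simps AE_lebesgue_const)
  show "norm F = 0 \<longleftrightarrow> F = 0"
  proof (transfer, elim conjE)
    fix f :: "'a \<Rightarrow> real" assume f: "f \<in> elements Linf"
    have "norm_in Linf f = 0 \<longleftrightarrow> norm_in Linf f \<le> 0" using norm_Linf_nonneg[OF f] by auto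
    then show "norm_in Linf f = 0 \<longleftrightarrow>
        f \<in> elements Linf \<and> (\<lambda>_. 0) \<in> elements Linf \<and> (AE x in lebesgue. f x = 0)"
      using f by (simp add: norm_Linf_le_iff Linf_const)
  qed
  show "norm (F + G) \<le> norm F + norm G"
  proof (transfer, elim conjE)
    fix f g :: "'a \<Rightarrow> real" assume f: "f \<in> elements Linf" and g: "g \<in> elements Linf"
    show "norm_in Linf (\<lambda>x. f x + g x) \<le> norm_in Linf f + norm_in Linf g"
      using AE_norm_Linf[OF f] AE_norm_Linf[OF g]
      unfolding norm_Linf_le_iff[OF Linf_add[OF f g]] by eventually_elim auto
  qed
  show "norm (c *\<^sub>R F) = \<bar>c\<bar> * norm F"
  proof (transfer, elim conjE)
    fix f :: "'a \<Rightarrow> real" and c assume f: "f \<in> elements Linf"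
    have *: "norm_in Linf (\<lambda>x. c * f x) \<le> \<bar>c\<bar> * norm_in Linf f" if f: "f \<in> elements Linf"
      for c and f :: "'a \<Rightarrow> real"
      using AE_norm_Linf[OF f] unfolding norm_Linf_le_iff[OF Linf_cmult[OF f]]
      by eventually_elim (auto simp: abs_mult intro: mult_left_mono)
    show "norm_in Linf (\<lambda>x. c * f x) = \<bar>c\<bar> * norm_in Linf f"
    proof (cases "c = 0")
      case True
      then show ?thesis
        using *[OF f, of 0] norm_Linf_nonneg[OF Linf_cmult[OF f, of 0]] by auto
    next
      case False
      have "norm_in Linf f \<le> \<bar>inverse c\<bar> * norm_in Linf (\<lambda>x. c * f x)"
        using *[OF Linf_cmult[OF f], of "inverse c" c] False by (simp add: mult.assoc[symmetric])
      then have "\<bar>c\<bar> * norm_in Linf f \<le> norm_in Linf (\<lambda>x. c * f x)"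
        using False by (simp add: field_simps)
      with *[OF f, of c] show ?thesis by auto
    qed
  qed
  show "norm (F * G) \<le> norm F * norm G"
  proof (transfer, elim conjE)
    fix f g :: "'a \<Rightarrow> real" assume f: "f \<in> elements Linf" and g: "g \<in> elements Linf"
    show "norm_in Linf (\<lambda>x. f x * g x) \<le> norm_in Linf f * norm_in Linf g"
      using AE_norm_Linf[OF f] AE_norm_Linf[OF g]
      unfolding norm_Linf_le_iff[OF Linf_mult[OF f g]]
      by eventually_elim (auto simp: abs_mult intro!: mult_mono norm_Linf_nonneg[OF f])
  qed
  show "norm (1 :: 'a linf) = 1"
  proof transfer
    have c: "(\<lambda>_::'a. 1) \<in> elements Linf" by (rule Linf_const)
    have "1 \<le> norm_in Linf (\<lambda>_::'a. 1)"
      using AE_norm_Linf[OF c] by (simp add: AE_lebesgue_const)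
    moreover have "norm_in Linf (\<lambda>_::'a. 1) \<le> 1" using norm_Linf_le_iff[OF c] by simp
    ultimately show "norm_in Linf (\<lambda>_::'a. 1) = 1" by simp
  qed
qed

end

lemma cls_cases:
  obtains f where "f \<in> elements Linf" "F = cls f"
  using Quotient_rep_abs[OF Quotient_linf] Quotient_abs_rep[OF Quotient_linf]
    Quotient_rep_reflp[OF Quotient_linf] by metis

lemma cls_eq_iff:
  "f \<in> elements Linf \<Longrightarrow> g \<in> elements Linf \<Longrightarrow> cls f = cls g \<longleftrightarrow> (AE x in lebesgue. f x = g x)"
  using Quotient_rel[OF Quotient_linf, of f g] by (auto simp del: elements.simps)

lemma cls_add:
  assumes "f \<in> elements Linf" "g \<in> elements Linf"
  shows "cls (\<lambda>x. f x + g x) = cls f + cls g"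
  using assms by (simp add: plus_linf.abs_eq)

lemma cls_diff:
  assumes "f \<in> elements Linf" "g \<in> elements Linf"
  shows "cls (\<lambda>x. f x - g x) = cls f - cls g"
  using assms by (simp add: minus_linf.abs_eq)

lemma cls_mult:
  assumes "f \<in> elements Linf" "g \<in> elements Linf"
  shows "cls (\<lambda>x. f x * g x) = cls f * cls g"
  using assms by (simp add: times_linf.abs_eq)

lemma cls_cmult: "f \<in> elements Linf \<Longrightarrow> cls (\<lambda>x. c * f x) = c *\<^sub>R cls f"
  by (simp add: scaleR_linf.abs_eq)

lemma norm_cls: "f \<in> elements Linf \<Longrightarrow> norm (cls f) = norm_in Linf f"
  by (simp add: norm_linf.abs_eq)

lemma norm_cls_le_iff: "f \<in> elements Linf \<Longrightarrow> norm (cls f) \<le> C \<longleftrightarrow> (AE x in lebesgue. \<bar>f x\<bar> \<le> C)"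
  by (simp add: norm_Linf_le_iff norm_cls)

lemma cls_const: "cls (\<lambda>_. c) = of_real c"
  using cls_cmult[OF Linf_const[of 1], of c]
  by (simp add: one_linf_def of_real_def map_fun_def)

text \<open>
  A Cauchy sequence of classes has representatives that are uniformly Cauchy off one null set,
  since only countably many inequalities are involved; their pointwise limit represents the limit.
\<close>

instance linf :: (euclidean_space) banach
proof
  fix X :: "nat \<Rightarrow> 'a linf"
  assume X: "Cauchy X"
  have "\<exists>f. f \<in> elements Linf \<and> X n = cls f" for n using cls_cases[of "X n"] by metis
  then obtain f where f: "\<And>n. f n \<in> elements Linf" and Xf: "\<And>n. X n = cls (f n)" by metis
  have diff: "norm (X n - X k) \<le> C \<longleftrightarrow> (AE x in lebesgue. \<bar>f n x - f k x\<bar> \<le> C)" for n k C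
    unfolding Xf cls_diff[OF f f, symmetric] norm_cls_le_iff[OF Linf_diff[OF f f]] ..
  have "AE x in lebesgue. \<forall>n k. \<bar>f n x - f k x\<bar> \<le> norm (X n - X k)"
    using diff[THEN iffD1, OF order_refl] by (simp add: AE_all_countable)
  then have good: "AE x in lebesgue. (\<lambda>n. f n x) \<longlonglongrightarrow> lim (\<lambda>n. f n x) \<and>
      (\<forall>n k. \<bar>f n x - f k x\<bar> \<le> norm (X n - X k))"
  proof eventually_elim
    case (elim x)
    have "Cauchy (\<lambda>n. f n x)"
    proof (rule metric_CauchyI)
      fix e :: real assume "0 < e"
      then obtain N where "\<And>n k. N \<le> n \<Longrightarrow> N \<le> k \<Longrightarrow> dist (X n) (X k) < e"
        using metric_CauchyD[OF X] by blast
      then show "\<exists>M. \<forall>m\<ge>M. \<forall>n\<ge>M. dist (f m x) (f n x) < e"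
        using elim by (metis dist_norm le_less_trans real_norm_def)
    qed
    then show ?case using elim by (simp add: Cauchy_convergent_iff convergent_LIMSEQ_iff)
  qed
  define g where "g x = lim (\<lambda>n. f n x)" for x
  have g_meas: "g \<in> borel_measurable lebesgue"
    unfolding g_def using Linf_measurable[OF f] by (intro borel_measurable_lim_metric) auto
  have close: "\<exists>N. \<forall>n\<ge>N. AE x in lebesgue. \<bar>f n x - g x\<bar> \<le> e" if "0 < e" for e :: real
  proof -
    obtain N where N: "\<And>n k. N \<le> n \<Longrightarrow> N \<le> k \<Longrightarrow> dist (X n) (X k) < e"
      using metric_CauchyD[OF X \<open>0 < e\<close>] by blast
    have "AE x in lebesgue. \<bar>f n x - g x\<bar> \<le> e" if "N \<le> n" for n
      using good
    proof eventually_elim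
      case (elim x)
      then have "(\<lambda>k. \<bar>f n x - f k x\<bar>) \<longlonglongrightarrow> \<bar>f n x - g x\<bar>"
        unfolding g_def by (intro tendsto_intros) auto
      moreover have "\<bar>f n x - f k x\<bar> \<le> e" if "N \<le> k" for k
        using elim N[OF \<open>N \<le> n\<close> that] unfolding dist_norm
        by (meson less_imp_le order_trans)
      ultimately show ?case by (intro LIMSEQ_le_const2[of _ _ e]) auto
    qed
    then show ?thesis by blast
  qed
  obtain N where "AE x in lebesgue. \<bar>f N x - g x\<bar> \<le> 1" using close[of 1] by auto
  moreover obtain C where "AE x in lebesgue. \<bar>f N x\<bar> \<le> C" using Linf_boundE[OF f] by metis
  ultimately have "AE x in lebesgue. \<bar>g x\<bar> \<le> C + 1" by eventually_elim auto
  then have g: "g \<in> elements Linf" using g_meas by (auto simp: elements_Linf_iff)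
  have "X \<longlonglongrightarrow> cls g"
  proof (rule metric_LIMSEQ_I)
    fix e :: real assume "0 < e"
    then obtain N where N: "\<And>n. N \<le> n \<Longrightarrow> AE x in lebesgue. \<bar>f n x - g x\<bar> \<le> e / 2"
      using close[of "e/2"] by auto
    have "dist (X n) (cls g) < e" if "N \<le> n" for n
    proof -
      have "dist (X n) (cls g) \<le> e / 2"
        unfolding dist_norm Xf cls_diff[OF f g, symmetric] norm_cls_le_iff[OF Linf_diff[OF f g]]
        using N[OF that] .
      then show ?thesis using \<open>0 < e\<close> by simp
    qed
    then show "\<exists>N. \<forall>n\<ge>N. dist (X n) (cls g) < e" by blast
  qed
  then show "convergent X" by (rule convergentI)
qed

section \<open>The three function spaces as closed subalgebras\<close>

text \<open>Nonempty open sets are not negligible, hence a continuous function that belongs to a closed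
  set almost everywhere does so everywhere. This embeds \<open>Cub\<close> and \<open>Cb\<close> isometrically in \<open>Linf\<close>.\<close>

lemma AE_continuous_imp_all:
  fixes f :: "'a::euclidean_space \<Rightarrow> real"
  assumes "continuous_on UNIV f" "closed S" "AE x in lebesgue. f x \<in> S"
  shows "f x \<in> S"
proof -
  let ?U = "f -` (- S)"
  have "open ?U" using assms(1,2) by (simp add: continuous_on_open_vimage open_Compl)
  moreover obtain N where "negligible N" "{x. f x \<notin> S} \<subseteq> N"
    using assms(3) by (auto simp: eventually_ae_filter_negligible)
  then have "negligible ?U" by (auto intro: negligible_subset)
  ultimately have "?U = {}" using open_not_negligible by blast
  then show ?thesis by auto
qed

lemma elements_cont_iff:
  assumes "E \<noteq> Linf"
  shows "f \<in> elements E \<longleftrightarrow> continuous_on UNIV f \<and> (\<exists>C. \<forall>x. \<bar>f x\<bar> \<le> C) \<and>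
    (E = Cub \<longrightarrow> uniformly_continuous_on UNIV f)"
  using assms by (cases E) (auto simp: elements.simps bcontfun_def bounded_iff)

lemma elements_boundE:
  assumes "f \<in> elements E" "E \<noteq> Linf"
  obtains C where "\<And>x. \<bar>f x\<bar> \<le> C"
  using assms by (auto simp: elements_cont_iff)

lemma elements_Linf: "f \<in> elements E \<Longrightarrow> f \<in> elements Linf"
  for f :: "'a::euclidean_space \<Rightarrow> real"
proof (cases "E = Linf")
  case False
  assume "f \<in> elements E"
  then have "continuous_on UNIV f" and *: "\<exists>C. \<forall>x. \<bar>f x\<bar> \<le> C"
    using False by (auto simp: elements_cont_iff)
  then have "f \<in> borel_measurable lebesgue"
    by (simp add: borel_measurable_continuous_onI measurable_completion)
  with * show ?thesis by (auto simp: elements_Linf_iff)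
qed simp

lemma elements_const: "(\<lambda>x::'a::euclidean_space. c) \<in> elements E"
  by (cases "E = Linf") (auto simp: Linf_const elements_cont_iff uniformly_continuous_on_const)

lemma elements_add:
  fixes f g :: "'a::euclidean_space \<Rightarrow> real"
  assumes "f \<in> elements E" "g \<in> elements E"
  shows "(\<lambda>x. f x + g x) \<in> elements E"
proof (cases "E = Linf")
  case False
  obtain C where C: "\<And>x. \<bar>f x\<bar> \<le> C" using elements_boundE[OF assms(1) False] by blast
  obtain D where D: "\<And>x. \<bar>g x\<bar> \<le> D" using elements_boundE[OF assms(2) False] by blast
  have "\<bar>f x + g x\<bar> \<le> C + D" for x using C[of x] D[of x] by linarith
  then show ?thesis
    using False assms by (auto simp: elements_cont_iff intro!: continuous_intros uniformly_continuous_on_add)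
qed (use assms Linf_add in auto)

lemma elements_mult:
  fixes f g :: "'a::euclidean_space \<Rightarrow> real"
  assumes "f \<in> elements E" "g \<in> elements E"
  shows "(\<lambda>x. f x * g x) \<in> elements E"
proof (cases "E = Linf")
  case False
  obtain C where C: "\<And>x. \<bar>f x\<bar> \<le> C" using elements_boundE[OF assms(1) False] by blast
  obtain D where D: "\<And>x. \<bar>g x\<bar> \<le> D" using elements_boundE[OF assms(2) False] by blast
  have "0 \<le> C" "0 \<le> D" using C[of 0] D[of 0] by auto
  have "\<And>x. \<bar>f x * g x\<bar> \<le> C * D"
    unfolding abs_mult by (intro mult_mono C D \<open>0 \<le> C\<close>) simp
  moreover have "uniformly_continuous_on UNIV (\<lambda>x. f x * g x)"
    if uf: "uniformly_continuous_on UNIV f" and ug: "uniformly_continuous_on UNIV g"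
    unfolding uniformly_continuous_on_def
  proof (intro allI impI)
    fix e :: real assume "0 < e"
    define d where "d = e / (C + D + 1)"
    have "0 < d" using \<open>0 < e\<close> \<open>0 \<le> C\<close> \<open>0 \<le> D\<close> by (simp add: d_def)
    obtain p q where pq: "0 < p" "0 < q"
      and p: "\<And>x x'. dist x' x < p \<Longrightarrow> dist (f x') (f x) < d"
      and q: "\<And>x x'. dist x' x < q \<Longrightarrow> dist (g x') (g x) < d"
      using uf ug \<open>0 < d\<close> unfolding uniformly_continuous_on_def by (metis UNIV_I)
    have "dist (f x' * g x') (f x * g x) < e" if "dist x' x < min p q" for x x'
    proof -
      have "\<bar>f x' * g x' - f x * g x\<bar> = \<bar>(f x' - f x) * g x' + f x * (g x' - g x)\<bar>"
        by (simp add: algebra_simps)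
      also have "\<dots> \<le> \<bar>f x' - f x\<bar> * \<bar>g x'\<bar> + \<bar>f x\<bar> * \<bar>g x' - g x\<bar>"
        by (metis abs_mult abs_triangle_ineq)
      also have "\<dots> \<le> d * D + C * d"
        using p[of x' x] q[of x' x] that C[of x] D[of x'] \<open>0 \<le> C\<close> \<open>0 < d\<close>
        by (intro add_mono mult_mono) (auto simp: dist_real_def)
      also have "\<dots> = d * (C + D + 1) - d" by (simp add: algebra_simps)
      also have "\<dots> = e - d" using \<open>0 \<le> C\<close> \<open>0 \<le> D\<close> by (simp add: d_def)
      also have "\<dots> < e" using \<open>0 < d\<close> by simp
      finally show ?thesis by (simp add: dist_real_def)
    qed
    then show "\<exists>d>0. \<forall>x\<in>UNIV. \<forall>x'\<in>UNIV. dist x' x < d \<longrightarrow> dist (f x' * g x') (f x * g x) < e"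
      using pq by (intro exI[of _ "min p q"]) auto
  qed
  ultimately show ?thesis
    using False assms by (auto simp: elements_cont_iff intro!: continuous_intros)
qed (use assms Linf_mult in auto)

lemma elements_cmult: "f \<in> elements E \<Longrightarrow> (\<lambda>x. c * f x) \<in> elements E"
  for f :: "'a::euclidean_space \<Rightarrow> real"
  using elements_mult[OF elements_const[of c]] by blast

lemma elements_diff:
  fixes f g :: "'a::euclidean_space \<Rightarrow> real"
  assumes "f \<in> elements E" "g \<in> elements E"
  shows "(\<lambda>x. f x - g x) \<in> elements E"
  using elements_add[OF assms(1) elements_cmult[OF assms(2), of "-1"]] by simp

text \<open>
  Since closed pointwise conditions may be checked almost everywhere in all three spaces, the
  relations \<open>eq_in\<close>, \<open>le_in\<close> and the norm have one description for all of them.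
\<close>

lemma holds_in_closed_iff:
  fixes f :: "'a::euclidean_space \<Rightarrow> real"
  assumes "f \<in> elements E" "closed S"
  shows "holds_in E (\<lambda>x. f x \<in> S) \<longleftrightarrow> (AE x in lebesgue. f x \<in> S)"
proof (cases "E = Linf")
  case False
  then have "continuous_on UNIV f" using assms(1) by (simp add: elements_cont_iff)
  from AE_continuous_imp_all[OF this assms(2)]
  have "(\<forall>x. f x \<in> S) \<longleftrightarrow> (AE x in lebesgue. f x \<in> S)" by (meson always_eventually)
  then show ?thesis using False by (cases E) auto
qed simp

lemma le_in_iff_AE:
  fixes v w :: "'a::euclidean_space \<Rightarrow> real"
  assumes "v \<in> elements E" "w \<in> elements E"
  shows "le_in E v w \<longleftrightarrow> (AE x in lebesgue. v x \<le> w x)"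
  using holds_in_closed_iff[OF elements_diff[OF assms(2,1)], of "{0..}"] by (simp add: le_in_def)

lemma eq_in_iff_cls:
  fixes v w :: "'a::euclidean_space \<Rightarrow> real"
  assumes "v \<in> elements E" "w \<in> elements E"
  shows "eq_in E v w \<longleftrightarrow> cls v = cls w"
  using holds_in_closed_iff[OF elements_diff[OF assms], of "{0}"] assms[THEN elements_Linf]
  by (simp add: eq_in_def cls_eq_iff)

lemma norm_in_eq_norm_cls:
  fixes f :: "'a::euclidean_space \<Rightarrow> real"
  assumes f: "f \<in> elements E"
  shows "norm_in E f = norm (cls f)"
proof (cases "E = Linf")
  case False
  note fL = elements_Linf[OF f]
  have cont: "continuous_on UNIV f" using False f by (simp add: elements_cont_iff)
  have iff: "norm (cls f) \<le> C \<longleftrightarrow> (\<forall>x. \<bar>f x\<bar> \<le> C)" for C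
  proof -
    have "norm (cls f) \<le> C \<longleftrightarrow> (AE x in lebesgue. f x \<in> {-C..C})"
      using norm_cls_le_iff[OF fL] by (simp add: abs_le_iff minus_le_iff conj_commute)
    also have "\<dots> \<longleftrightarrow> (\<forall>x. f x \<in> {-C..C})"
      using AE_continuous_imp_all[OF cont closed_atLeastAtMost] by (meson always_eventually)
    finally show ?thesis by (auto simp: abs_le_iff minus_le_iff)
  qed
  have "(SUP x. \<bar>f x\<bar>) = norm (cls f)"
  proof (rule antisym)
    show "(SUP x. \<bar>f x\<bar>) \<le> norm (cls f)" using iff by (intro cSUP_least) auto
    have "bdd_above (range (\<lambda>x. \<bar>f x\<bar>))" using iff[of "norm (cls f)"] by (intro bdd_aboveI2) auto
    then show "norm (cls f) \<le> (SUP x. \<bar>f x\<bar>)" unfolding iff by (auto intro: cSUP_upper)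
  qed
  then show ?thesis using False by (cases E) auto
qed (use f in \<open>simp add: norm_cls elements_Linf\<close>)

text \<open>The classes of the elements of the space \<open>E\<close>; all classes if \<open>E\<close> is \<open>Linf\<close>.\<close>

definition classes :: "fspace \<Rightarrow> 'a::euclidean_space linf set" where
  "classes E = cls ` elements E"

lemma cls_in_classes: "v \<in> elements E \<Longrightarrow> cls v \<in> classes E"
  by (simp add: classes_def)

lemma classesE:
  assumes "V \<in> classes E"
  obtains v where "v \<in> elements E" "V = cls v"
  using assms by (auto simp: classes_def)

lemma subspace_classes: "subspace (classes E)"
proof (rule subspaceI)
  show "0 \<in> classes E" using cls_in_classes[OF elements_const[of 0]] by (simp add: cls_const)
  show "V + W \<in> classes E" if V: "V \<in> classes E" and W: "W \<in> classes E" for V W :: "'a linf"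
    using V W by (elim classesE)
      (simp add: cls_add[OF elements_Linf elements_Linf, symmetric] cls_in_classes elements_add)
  show "c *\<^sub>R V \<in> classes E" if V: "V \<in> classes E" for c and V :: "'a linf"
    using V by (elim classesE)
      (simp add: cls_cmult[OF elements_Linf, symmetric] cls_in_classes elements_cmult)
qed

lemma classes_mult: "V \<in> classes E \<Longrightarrow> W \<in> classes E \<Longrightarrow> V * W \<in> classes E"
  for V W :: "'a::euclidean_space linf"
  by (elim classesE)
      (simp add: cls_mult[OF elements_Linf elements_Linf, symmetric] cls_in_classes elements_mult)

lemma closed_classes: "closed (classes E :: 'a::euclidean_space linf set)"
proof (cases "E = Linf")
  case True
  then have "classes E = (UNIV :: 'a linf set)" by (metis UNIV_eq_I cls_cases cls_in_classes)
  then show ?thesis by simp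
next
  case False
  show ?thesis
    unfolding closed_sequential_limits
  proof (intro allI impI, elim conjE)
    fix X :: "nat \<Rightarrow> 'a linf" and F
    assume "\<forall>n. X n \<in> classes E" and lim: "X \<longlonglongrightarrow> F"
    then have "\<forall>n. \<exists>f. f \<in> elements E \<and> X n = cls f" by (blast elim: classesE)
    then obtain f where f: "\<And>n. f n \<in> elements E" and Xf: "\<And>n. X n = cls (f n)"
      by metis
    have fL: "f n \<in> elements Linf" for n using f elements_Linf by blast
    have diff: "\<bar>f n x - f k x\<bar> \<le> norm (X n - X k)" for n k x
    proof -
      have el: "(\<lambda>x. f n x - f k x) \<in> elements E" by (rule elements_diff[OF f f])
      obtain C where "\<And>x. \<bar>f n x - f k x\<bar> \<le> C" using elements_boundE[OF el False] by blast
      then have "bdd_above (range (\<lambda>x. \<bar>f n x - f k x\<bar>))" by (intro bdd_aboveI2)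
      then have "\<bar>f n x - f k x\<bar> \<le> (SUP x. \<bar>f n x - f k x\<bar>)" by (intro cSUP_upper) auto
      also have "\<dots> = norm_in E (\<lambda>x. f n x - f k x)" using False by (cases E) auto
      also have "\<dots> = norm (X n - X k)"
        using norm_in_eq_norm_cls[OF el] by (simp add: Xf cls_diff[OF fL fL])
      finally show ?thesis .
    qed
    have "uniformly_Cauchy_on UNIV f"
    proof (rule uniformly_Cauchy_onI)
      fix e :: real assume "0 < e"
      then obtain N where "\<And>n k. N \<le> n \<Longrightarrow> N \<le> k \<Longrightarrow> dist (X n) (X k) < e"
        using metric_CauchyD[OF LIMSEQ_imp_Cauchy[OF lim]] by blast
      then show "\<exists>M. \<forall>x\<in>UNIV. \<forall>m\<ge>M. \<forall>n\<ge>M. dist (f m x) (f n x) < e"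
        using diff by (metis dist_norm le_less_trans real_norm_def)
    qed
    then obtain g where g: "uniform_limit UNIV f g sequentially"
      using Cauchy_uniformly_convergent uniformly_convergent_on_def by blast
    then have ev: "\<exists>n. \<forall>k\<ge>n. \<forall>x. \<bar>f k x - g x\<bar> < e" if "0 < e" for e
      using that by (auto simp: uniform_limit_iff eventually_sequentially dist_real_def)
    have "continuous_on UNIV g"
      using f False by (intro uniform_limit_theorem[OF _ g]) (auto simp: elements_cont_iff)
    moreover have "\<exists>C. \<forall>x. \<bar>g x\<bar> \<le> C"
    proof -
      obtain n where n: "\<And>x. \<bar>f n x - g x\<bar> < 1" using ev[of 1] by auto
      obtain C where C: "\<And>x. \<bar>f n x\<bar> \<le> C" using elements_boundE[OF f False] by blast
      have "\<bar>g x\<bar> \<le> C + 1" for x using n[of x] C[of x] by linarith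
      then show ?thesis by blast
    qed
    moreover have "uniformly_continuous_on UNIV g" if "E = Cub"
      unfolding uniformly_continuous_on_def
    proof (intro allI impI)
      fix e :: real assume "0 < e"
      then obtain n where n: "\<And>x. \<bar>f n x - g x\<bar> < e / 3" using ev[of "e/3"] by auto
      have "uniformly_continuous_on UNIV (f n)" using f[of n] that by (simp add: elements_cont_iff)
      then obtain d where "0 < d" and d: "\<And>x x'. dist x' x < d \<Longrightarrow> dist (f n x') (f n x) < e / 3"
        using \<open>0 < e\<close> unfolding uniformly_continuous_on_def by (metis UNIV_I divide_pos_pos zero_less_numeral)
      have "dist (g x') (g x) < e" if "dist x' x < d" for x x'
        using d[OF that] n[of x] n[of x'] unfolding dist_real_def by linarith
      then show "\<exists>d>0. \<forall>x\<in>UNIV. \<forall>x'\<in>UNIV. dist x' x < d \<longrightarrow> dist (g x') (g x) < e"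
        using \<open>0 < d\<close> by blast
    qed
    ultimately have gE: "g \<in> elements E" using False by (simp add: elements_cont_iff)
    have "X \<longlonglongrightarrow> cls g"
    proof (rule metric_LIMSEQ_I)
      fix e :: real assume "0 < e"
      then obtain n where n: "\<And>k x. n \<le> k \<Longrightarrow> \<bar>f k x - g x\<bar> < e / 2" using ev[of "e/2"] by auto
      have "dist (X k) (cls g) < e" if "n \<le> k" for k
      proof -
        have "dist (X k) (cls g) \<le> e / 2"
          unfolding dist_norm Xf cls_diff[OF fL elements_Linf[OF gE], symmetric]
            norm_cls_le_iff[OF Linf_diff[OF fL elements_Linf[OF gE]]]
          using n[OF that] by (simp add: less_imp_le)
        then show ?thesis using \<open>0 < e\<close> by simp
      qed
      then show "\<exists>n. \<forall>k\<ge>n. dist (X k) (cls g) < e" by blast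
    qed
    with lim have "F = cls g" by (rule LIMSEQ_unique)
    with gE show "F \<in> classes E" by (simp add: cls_in_classes)
  qed
qed

section \<open>Order intervals as norm balls\<close>

text \<open>
  For a class \<open>V\<close> of functions, \<open>0 \<le> V \<le> r\<close> almost everywhere if and only if \<open>V\<close> lies in the ball
  of radius \<open>r/2\<close> about the constant \<open>r/2\<close>. This ball makes sense in every normed algebra with
  unit, and is taken there as the definition of the order interval from 0 to \<open>r\<close>.
\<close>

definition order_interval :: "real \<Rightarrow> 'b::real_normed_algebra_1 set" where
  "order_interval r = cball (of_real (r / 2)) (r / 2)"

lemma order_interval_iff: "v \<in> order_interval r \<longleftrightarrow> norm (v - of_real (r / 2)) \<le> r / 2"
  by (simp add: order_interval_def dist_norm norm_minus_commute)

lemma order_interval_nonneg: "V \<in> order_interval r \<Longrightarrow> 0 \<le> r"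
  unfolding order_interval_iff using norm_ge_zero[of "V - of_real (r / 2)"] by linarith

lemma order_interval_norm_le:
  assumes "V \<in> order_interval r"
  shows "norm V \<le> r"
proof -
  have "norm V \<le> norm (V - of_real (r / 2)) + norm (of_real (r / 2) :: 'a)"
    using norm_triangle_ineq[of "V - of_real (r / 2)" "of_real (r / 2)"] by simp
  then show ?thesis
    using assms order_interval_nonneg[OF assms] unfolding order_interval_iff norm_of_real by simp
qed

lemma zero_in_order_interval: "0 \<le> r \<Longrightarrow> 0 \<in> order_interval r"
  unfolding order_interval_iff by (simp del: of_real_divide)

lemma order_interval_add:
  assumes "V \<in> order_interval r" "W \<in> order_interval s"
  shows "V + W \<in> order_interval (r + s)"
proof -
  have "V + W - of_real ((r + s) / 2) = (V - of_real (r / 2)) + (W - of_real (s / 2))"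
    by (simp add: add_divide_distrib)
  then show ?thesis
    using assms norm_triangle_ineq[of "V - of_real (r / 2)" "W - of_real (s / 2)"]
    unfolding order_interval_iff by (simp only: add_divide_distrib)
qed

lemma order_interval_scale:
  assumes "V \<in> order_interval r" "0 \<le> c"
  shows "c *\<^sub>R V \<in> order_interval (c * r)"
proof -
  have "c *\<^sub>R V - of_real (c * r / 2) = c *\<^sub>R (V - of_real (r / 2))"
    by (simp add: of_real_def scaleR_diff_right)
  then show ?thesis
    using assms mult_left_mono[of "norm (V - of_real (r / 2))" "r / 2" c]
    unfolding order_interval_iff by simp
qed

lemma order_interval_compl:
  assumes "V \<in> order_interval r"
  shows "of_real r - V \<in> order_interval r"
proof -
  have "of_real r - V - of_real (r / 2) = - (V - of_real (r / 2))"
    unfolding of_real_def by (simp add: scaleR_diff_left[symmetric] algebra_simps flip: scaleR_add_left)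
  then show ?thesis using assms unfolding order_interval_iff by (simp only: norm_minus_cancel)
qed

lemma order_interval_mono:
  assumes "V \<in> order_interval r" "r \<le> s"
  shows "V \<in> order_interval s"
proof -
  have "V - of_real (s / 2) = (V - of_real (r / 2)) + of_real (r / 2 - s / 2)"
    by (simp del: of_real_divide)
  also have "norm \<dots> \<le> norm (V - of_real (r / 2)) + norm (of_real (r / 2 - s / 2) :: 'a)"
    by (rule norm_triangle_ineq)
  also have "\<dots> \<le> s / 2" using assms unfolding order_interval_iff norm_of_real by simp
  finally show ?thesis unfolding order_interval_iff .
qed

lemma order_interval_integral:
  fixes g :: "real \<Rightarrow> 'b::{banach, real_normed_algebra_1}"
  assumes g: "g integrable_on {a..b}" and \<rho>: "(\<rho> has_integral I) {a..b}"
    and mem: "\<And>s. s \<in> {a..b} \<Longrightarrow> g s \<in> order_interval (\<rho> s)"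
  shows "integral {a..b} g \<in> order_interval I"
proof -
  have \<rho>2: "((\<lambda>s. \<rho> s / 2) has_integral I / 2) {a..b}" using \<rho> by (rule has_integral_divide)
  have \<rho>b: "((\<lambda>s. of_real (\<rho> s / 2)) has_integral (of_real (I / 2) :: 'b)) {a..b}"
    using has_integral_linear[OF \<rho>2 bounded_linear_of_real] by (simp only: o_def)
  have "integral {a..b} g - of_real (I / 2) = integral {a..b} (\<lambda>s. g s - of_real (\<rho> s / 2))"
    using integral_diff[OF g has_integral_integrable[OF \<rho>b]] integral_unique[OF \<rho>b] by simp
  also have "norm \<dots> \<le> integral {a..b} (\<lambda>s. \<rho> s / 2)"
  proof (rule integral_norm_bound_integral)
    show "(\<lambda>s. g s - of_real (\<rho> s / 2)) integrable_on {a..b}"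
      by (intro integrable_diff g has_integral_integrable[OF \<rho>b])
    show "(\<lambda>s. \<rho> s / 2) integrable_on {a..b}" using \<rho>2 by (rule has_integral_integrable)
    show "norm (g s - of_real (\<rho> s / 2)) \<le> \<rho> s / 2" if "s \<in> {a..b}" for s
      using mem[OF that] unfolding order_interval_iff .
  qed
  also have "\<dots> = I / 2" using \<rho>2 by (rule integral_unique)
  finally show ?thesis unfolding order_interval_iff .
qed

lemma cls_in_order_interval_iff:
  assumes "f \<in> elements Linf"
  shows "cls f \<in> order_interval r \<longleftrightarrow> (AE x in lebesgue. 0 \<le> f x \<and> f x \<le> r)"
proof -
  have "cls f - of_real (r / 2) = cls (\<lambda>x. f x - r / 2)"
    using cls_diff[OF assms Linf_const[of "r/2"]] by (simp add: cls_const)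
  moreover have "\<bar>f x - r / 2\<bar> \<le> r / 2 \<longleftrightarrow> 0 \<le> f x \<and> f x \<le> r" for x
    unfolding abs_le_iff by (auto simp: field_simps)
  ultimately show ?thesis
    using norm_cls_le_iff[OF Linf_diff[OF assms Linf_const], of "r/2" "r/2"]
    by (simp add: order_interval_iff)
qed

lemma tube_iff_cls:
  fixes v :: "'a::euclidean_space \<Rightarrow> real"
  assumes v: "v \<in> elements E"
  shows "v \<in> tube E r \<longleftrightarrow> cls v \<in> order_interval r"
  using v by (simp add: tube_def le_in_iff_AE elements_const cls_in_order_interval_iff elements_Linf)

lemma nonneg_iff_cls:
  fixes v :: "'a::euclidean_space \<Rightarrow> real"
  assumes v: "v \<in> elements E" and r: "norm (cls v) \<le> r"
  shows "le_in E (\<lambda>x. 0) v \<longleftrightarrow> cls v \<in> order_interval r"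
proof -
  have "AE x in lebesgue. \<bar>v x\<bar> \<le> r" using norm_cls_le_iff[OF elements_Linf[OF v]] r by simp
  then have "(AE x in lebesgue. 0 \<le> v x) \<longleftrightarrow> (AE x in lebesgue. 0 \<le> v x \<and> v x \<le> r)"
    by (auto elim: eventually_elim2)
  then show ?thesis
    using v by (simp add: le_in_iff_AE elements_const cls_in_order_interval_iff elements_Linf)
qed

lemma order_interval_mult:
  fixes V W :: "'a::euclidean_space linf"
  assumes "V \<in> order_interval r" "W \<in> order_interval s"
  shows "V * W \<in> order_interval (r * s)"
proof -
  obtain v w where v: "v \<in> elements Linf" "V = cls v" and w: "w \<in> elements Linf" "W = cls w"
    using cls_cases by metis
  have "AE x in lebesgue. 0 \<le> v x \<and> v x \<le> r" "AE x in lebesgue. 0 \<le> w x \<and> w x \<le> s"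
    using assms v w by (auto simp: cls_in_order_interval_iff)
  then have "AE x in lebesgue. 0 \<le> v x * w x \<and> v x * w x \<le> r * s"
    by eventually_elim (auto intro: mult_mono)
  then show ?thesis
    using v w by (simp add: cls_mult[symmetric] cls_in_order_interval_iff Linf_mult)
qed

section \<open>Convolution with a probability density\<close>

lemma distr_lebesgue_reflect:
  fixes x :: "'a::euclidean_space"
  shows "distr lebesgue lebesgue (\<lambda>y. x - y) = lebesgue"
    and measurable_lebesgue_reflect: "(\<lambda>y. x - y) \<in> lebesgue \<rightarrow>\<^sub>M lebesgue"
proof -
  have T: "(\<lambda>y. x + (\<Sum>j\<in>Basis. (- 1 * (y \<bullet> j)) *\<^sub>R j)) = (\<lambda>y. x - y)"
    by (simp add: sum_negf euclidean_representation)
  show "(\<lambda>y. x - y) \<in> lebesgue \<rightarrow>\<^sub>M lebesgue"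
    using lebesgue_affine_measurable[of "\<lambda>_. - 1" x] unfolding T by simp
  show "distr lebesgue lebesgue (\<lambda>y. x - y) = lebesgue"
    using lebesgue_affine_euclidean[of "\<lambda>_. - 1" x] unfolding T by (simp add: density_1)
qed

lemma AE_lebesgue_reflect:
  fixes x :: "'a::euclidean_space"
  assumes "AE y in lebesgue. P y"
  shows "AE y in lebesgue. P (x - y)"
proof -
  have "AE y in distr lebesgue lebesgue (\<lambda>y. x - y). P y"
    unfolding distr_lebesgue_reflect by (rule assms)
  then show ?thesis by (rule AE_distrD[OF measurable_lebesgue_reflect])
qed

lemma integral_lebesgue_reflect:
  fixes x :: "'a::euclidean_space" and f :: "'a \<Rightarrow> real"
  assumes "f \<in> borel_measurable lebesgue"
  shows "(LINT y|lebesgue. f (x - y)) = (LINT y|lebesgue. f y)"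
  using integral_distr[OF measurable_lebesgue_reflect assms, of x] by (simp add: distr_lebesgue_reflect)

lemma integrable_lebesgue_reflect:
  fixes x :: "'a::euclidean_space" and f :: "'a \<Rightarrow> real"
  assumes "integrable lebesgue f"
  shows "integrable lebesgue (\<lambda>y. f (x - y))"
  using integrable_distr[OF measurable_lebesgue_reflect[of x], of f] assms
  by (simp add: distr_lebesgue_reflect)

lemma Linf_reflect:
  fixes v :: "'a::euclidean_space \<Rightarrow> real"
  assumes "v \<in> elements Linf"
  shows "(\<lambda>y. v (x - y)) \<in> elements Linf"
proof -
  obtain C where "AE y in lebesgue. \<bar>v y\<bar> \<le> C" using Linf_boundE[OF assms] by metis
  then have "AE y in lebesgue. \<bar>v (x - y)\<bar> \<le> C" by (rule AE_lebesgue_reflect)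
  moreover have "(\<lambda>y. v (x - y)) \<in> borel_measurable lebesgue"
    using Linf_measurable[OF assms] measurable_lebesgue_reflect by (rule measurable_compose[rotated])
  ultimately show ?thesis by (auto simp: elements_Linf_iff)
qed

lemma integrable_mult_Linf:
  fixes a v :: "'a::euclidean_space \<Rightarrow> real"
  assumes a: "integrable lebesgue a" and v: "v \<in> elements Linf"
  shows "integrable lebesgue (\<lambda>y. a y * v y)"
proof -
  obtain C where C: "AE y in lebesgue. \<bar>v y\<bar> \<le> C" using Linf_boundE[OF v] by metis
  show ?thesis
  proof (rule Bochner_Integration.integrable_bound)
    show "integrable lebesgue (\<lambda>y. a y * C)" using a by simp
    show "(\<lambda>y. a y * v y) \<in> borel_measurable lebesgue"
      using a Linf_measurable[OF v] by (intro borel_measurable_times) auto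
    show "AE y in lebesgue. norm (a y * v y) \<le> norm (a y * C)"
      using C by eventually_elim (auto simp: abs_mult intro!: mult_left_mono)
  qed
qed

lemma abs_integral_mult_le:
  fixes a v :: "'a::euclidean_space \<Rightarrow> real"
  assumes a: "integrable lebesgue a" "AE y in lebesgue. 0 \<le> a y" and v: "v \<in> elements Linf"
    and C: "AE y in lebesgue. \<bar>v y\<bar> \<le> C"
  shows "\<bar>LINT y|lebesgue. a y * v y\<bar> \<le> C * (LINT y|lebesgue. a y)"
proof -
  have "\<bar>LINT y|lebesgue. a y * v y\<bar> \<le> (LINT y|lebesgue. \<bar>a y * v y\<bar>)"
    by (rule integral_abs_bound)
  also have "\<dots> \<le> (LINT y|lebesgue. a y * C)"
  proof (rule integral_mono_AE)
    show "integrable lebesgue (\<lambda>y. \<bar>a y * v y\<bar>)"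
      using integrable_mult_Linf[OF a(1) v] by (rule integrable_abs)
    show "integrable lebesgue (\<lambda>y. a y * C)" using a by simp
    show "AE y in lebesgue. \<bar>a y * v y\<bar> \<le> a y * C"
      using C a(2) by eventually_elim (auto simp: abs_mult intro!: mult_left_mono)
  qed
  finally show ?thesis by (simp add: mult.commute)
qed

lemma convolution_commute:
  fixes a v :: "'a::euclidean_space \<Rightarrow> real"
  assumes a: "integrable lebesgue a" and v: "v \<in> elements Linf"
  shows "convolution a v x = (LINT z|lebesgue. a z * v (x - z))"
  using integral_lebesgue_reflect[OF borel_measurable_integrable[OF
      integrable_mult_Linf[OF a Linf_reflect[OF v, of x]]], of x]
  by (simp add: convolution_def)

text \<open>
  Fubini's theorem is available for Borel functions, hence \<open>a\<close> and \<open>v\<close> are first replaced by Borel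
  functions. This changes the convolution at no point.
\<close>

lemma convolution_measurable:
  fixes a v :: "'a::euclidean_space \<Rightarrow> real"
  assumes a: "integrable lebesgue a" and v: "v \<in> elements Linf"
  shows "convolution a v \<in> borel_measurable lebesgue"
proof -
  obtain a' where a'[measurable]: "a' \<in> borel_measurable lborel" and aa': "AE x in lborel. a x = a' x"
    using completion_ex_borel_measurable_real[of a lborel] a by auto
  obtain v' where v'[measurable]: "v' \<in> borel_measurable lborel" and vv': "AE x in lborel. v x = v' x"
    using completion_ex_borel_measurable_real[OF Linf_measurable[OF v]] by auto
  have "convolution a v = (\<lambda>x. LINT y|lborel. a' (x - y) * v' y)"
  proof
    fix x
    have "convolution a v x = (LINT y|lebesgue. a' (x - y) * v' y)"
      unfolding convolution_def
    proof (rule integral_cong_AE)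
      show "(\<lambda>y. a (x - y) * v y) \<in> borel_measurable lebesgue"
        using integrable_lebesgue_reflect[OF a] Linf_measurable[OF v] by (intro borel_measurable_times) auto
      have "(\<lambda>y. a' (x - y) * v' y) \<in> borel_measurable lborel" by measurable
      then show "(\<lambda>y. a' (x - y) * v' y) \<in> borel_measurable lebesgue" by (rule measurable_completion)
      show "AE y in lebesgue. a (x - y) * v y = a' (x - y) * v' y"
        using AE_lebesgue_reflect[OF AE_completion[OF aa'], of x] AE_completion[OF vv']
        by eventually_elim simp
    qed
    also have "\<dots> = (LINT y|lborel. a' (x - y) * v' y)"
      by (rule integral_completion) measurable
    finally show "convolution a v x = (LINT y|lborel. a' (x - y) * v' y)" .
  qed
  moreover have "(\<lambda>x. LINT y|lborel. a' (x - y) * v' y) \<in> borel_measurable lborel"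
    by measurable
  ultimately show ?thesis by (simp only: measurable_completion)
qed

text \<open>The dispersal kernel: a probability density with respect to Lebesgue measure.\<close>

locale probability_kernel =
  fixes a :: "'a::euclidean_space \<Rightarrow> real"
  assumes integrable_a: "integrable lebesgue a" and nonneg_a: "AE x in lebesgue. 0 \<le> a x"
    and integral_a: "(LINT x|lebesgue. a x) = 1"
begin

lemma convolution_bound:
  assumes v: "v \<in> elements Linf" and C: "AE y in lebesgue. \<bar>v y\<bar> \<le> C"
  shows "\<bar>convolution a v x\<bar> \<le> C"
  unfolding convolution_commute[OF integrable_a v]
  using abs_integral_mult_le[OF integrable_a nonneg_a Linf_reflect[OF v] AE_lebesgue_reflect[OF C]] integral_a
  by simp

text \<open>
  In \<open>\<integral> a z * v (x - z) dz\<close> the variable \<open>x\<close> occurs in \<open>v\<close> only: continuity in \<open>x\<close> is dominated convergence,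
  and uniform continuity is inherited from \<open>v\<close> with the same modulus.
\<close>

lemma convolution_elements:
  assumes v: "v \<in> elements E"
  shows "convolution a v \<in> elements E"
proof -
  have vL: "v \<in> elements Linf" using v by (rule elements_Linf)
  note reflect = convolution_commute[OF integrable_a vL]
  obtain C where C: "AE y in lebesgue. \<bar>v y\<bar> \<le> C" using Linf_boundE[OF vL] by metis
  have bound: "\<bar>convolution a v x\<bar> \<le> C" for x by (rule convolution_bound[OF vL C])
  show ?thesis
  proof (cases "E = Linf")
    case True
    then show ?thesis
      using convolution_measurable[OF integrable_a vL] bound by (auto simp: elements_Linf_iff)
  next
    case False
    then have cont_v: "continuous_on UNIV v" using v by (simp add: elements_cont_iff)
    have "continuous_on UNIV (convolution a v)"
      unfolding continuous_on_sequentially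
    proof (intro ballI allI impI, elim conjE)
      fix s :: "nat \<Rightarrow> 'a" and x assume s: "s \<longlonglongrightarrow> x"
      obtain D where D: "\<And>x. \<bar>v x\<bar> \<le> D" using elements_boundE[OF v False] by blast
      have meas: "(\<lambda>z. a z * v (x - z)) \<in> borel_measurable lebesgue" for x
        using integrable_mult_Linf[OF integrable_a Linf_reflect[OF vL]] by (rule borel_measurable_integrable)
      have "(\<lambda>n. LINT z|lebesgue. a z * v (s n - z)) \<longlonglongrightarrow> (LINT z|lebesgue. a z * v (x - z))"
      proof (rule integral_dominated_convergence[where w="\<lambda>z. \<bar>a z\<bar> * D"])
        show "integrable lebesgue (\<lambda>z. \<bar>a z\<bar> * D)" using integrable_a by simp
        show "AE z in lebesgue. (\<lambda>n. a z * v (s n - z)) \<longlonglongrightarrow> a z * v (x - z)"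
        proof (intro AE_I2 tendsto_mult tendsto_const)
          fix z
          have "isCont v (x - z)" using cont_v by (simp add: continuous_on_eq_continuous_at)
          moreover have "(\<lambda>n. s n - z) \<longlonglongrightarrow> x - z" using s by (intro tendsto_intros)
          ultimately show "(\<lambda>n. v (s n - z)) \<longlonglongrightarrow> v (x - z)" by (rule isCont_tendsto_compose)
        qed
        show "AE z in lebesgue. norm (a z * v (s n - z)) \<le> \<bar>a z\<bar> * D" for n
          using D by (auto simp: abs_mult intro!: mult_left_mono AE_I2)
      qed (rule meas)+
      then show "(convolution a v \<circ> s) \<longlonglongrightarrow> convolution a v x" by (simp add: o_def reflect)
    qed
    moreover have "uniformly_continuous_on UNIV (convolution a v)" if "E = Cub"
      unfolding uniformly_continuous_on_def
    proof (intro allI impI)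
      fix e :: real assume "0 < e"
      have "uniformly_continuous_on UNIV v" using v that by (simp add: elements_cont_iff)
      then obtain d where "0 < d" and d: "\<And>x x'. dist x' x < d \<Longrightarrow> dist (v x') (v x) < e / 2"
        using \<open>0 < e\<close> unfolding uniformly_continuous_on_def by (metis UNIV_I half_gt_zero)
      have "dist (convolution a v x') (convolution a v x) < e" if "dist x' x < d" for x x'
      proof -
        have "convolution a v x' - convolution a v x = (LINT z|lebesgue. a z * (v (x' - z) - v (x - z)))"
          unfolding reflect
          by (subst Bochner_Integration.integral_diff[symmetric])
            (auto intro!: integrable_mult_Linf integrable_a Linf_reflect vL simp: right_diff_distrib)
        also have "\<bar>\<dots>\<bar> \<le> e / 2 * (LINT z|lebesgue. a z)"
          using d[of "x' - _" "x - _"] that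
          by (intro abs_integral_mult_le integrable_a nonneg_a Linf_diff Linf_reflect vL AE_I2)
            (auto simp: dist_real_def dist_norm less_imp_le)
        finally show ?thesis using \<open>0 < e\<close> integral_a by (simp add: dist_real_def)
      qed
      then show "\<exists>d>0. \<forall>x\<in>UNIV. \<forall>x'\<in>UNIV. dist x' x < d \<longrightarrow>
          dist (convolution a v x') (convolution a v x) < e"
        using \<open>0 < d\<close> by blast
    qed
    ultimately show ?thesis using False bound by (auto simp: elements_cont_iff)
  qed
qed

lemma convolution_const: "convolution a (\<lambda>_. c) = (\<lambda>_. c)"
  using integral_a by (simp add: fun_eq_iff convolution_commute[OF integrable_a Linf_const])

lemma convolution_add:
  assumes "v \<in> elements Linf" "w \<in> elements Linf"
  shows "convolution a (\<lambda>x. v x + w x) = (\<lambda>x. convolution a v x + convolution a w x)"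
  using assms
  by (simp add: fun_eq_iff convolution_commute integrable_a Linf_add distrib_left integrable_mult_Linf Linf_reflect)

lemma convolution_cmult:
  assumes "v \<in> elements Linf"
  shows "convolution a (\<lambda>x. c * v x) = (\<lambda>x. c * convolution a v x)"
  using assms
  by (simp add: fun_eq_iff convolution_commute integrable_a Linf_cmult mult.left_commute[of _ c])

lemma convolution_cong:
  assumes "v \<in> elements Linf" "w \<in> elements Linf" "AE x in lebesgue. v x = w x"
  shows "convolution a v = convolution a w"
proof
  fix x
  have "AE y in lebesgue. a (x - y) * v y = a (x - y) * w y"
    using assms(3) by eventually_elim simp
  then show "convolution a v x = convolution a w x"
    unfolding convolution_def using integrable_lebesgue_reflect[OF integrable_a] assms(1,2)[THEN Linf_measurable]
    by (intro integral_cong_AE borel_measurable_times) auto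
qed

end

text \<open>
  An element of the space \<open>E\<close> in the class \<open>V\<close>; it is unique if \<open>E\<close> is \<open>Cub\<close> or \<open>Cb\<close>, and arbitrary
  up to equality almost everywhere if \<open>E\<close> is \<open>Linf\<close>.
\<close>

definition representative :: "fspace \<Rightarrow> 'a::euclidean_space linf \<Rightarrow> 'a \<Rightarrow> real" where
  "representative E V = (SOME v. v \<in> elements E \<and> cls v = V)"

lemma representative:
  assumes "V \<in> classes E"
  shows "representative E V \<in> elements E" "cls (representative E V) = V"
  using someI_ex[of "\<lambda>v. v \<in> elements E \<and> cls v = V"] assms
  by (auto simp: representative_def classes_def)

text \<open>The operator that convolution with \<open>a\<close> induces on classes.\<close>

definition class_convolution :: "('a::euclidean_space \<Rightarrow> real) \<Rightarrow> 'a linf \<Rightarrow> 'a linf" where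
  "class_convolution a V = cls (convolution a (representative Linf V))"

context probability_kernel
begin

lemma class_convolution_cls:
  assumes v: "v \<in> elements Linf"
  shows "class_convolution a (cls v) = cls (convolution a v)"
proof -
  note rep = representative[OF cls_in_classes[OF v]]
  then have "convolution a (representative Linf (cls v)) = convolution a v"
    using convolution_cong[OF rep(1) v] cls_eq_iff[OF rep(1) v] by blast
  then show ?thesis by (simp add: class_convolution_def)
qed

lemma class_convolution_in_classes:
  assumes "V \<in> classes E"
  shows "class_convolution a V \<in> classes E"
  using assms by (elim classesE)
    (simp add: class_convolution_cls elements_Linf cls_in_classes convolution_elements)

lemma linear_class_convolution: "linear (class_convolution a)"
proof (rule linearI)
  fix V W :: "'a linf" and c :: real
  obtain v w where v: "v \<in> elements Linf" "V = cls v" and w: "w \<in> elements Linf" "W = cls w"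
    using cls_cases by metis
  note el = v(1) w(1) convolution_elements[OF v(1)] convolution_elements[OF w(1)]
  show "class_convolution a (V + W) = class_convolution a V + class_convolution a W"
    unfolding v(2) w(2) using el
    by (simp add: class_convolution_cls cls_add[symmetric] Linf_add convolution_add)
  show "class_convolution a (c *\<^sub>R V) = c *\<^sub>R class_convolution a V"
    unfolding v(2) using el
    by (simp add: class_convolution_cls cls_cmult[symmetric] Linf_cmult convolution_cmult)
qed

lemma norm_class_convolution: "norm (class_convolution a V) \<le> norm V"
proof -
  obtain v where v: "v \<in> elements Linf" "V = cls v" using cls_cases by metis
  have "AE x in lebesgue. \<bar>v x\<bar> \<le> norm V" using norm_cls_le_iff[OF v(1), of "norm V"] v(2) by simp
  then have "\<bar>convolution a v x\<bar> \<le> norm V" for x by (rule convolution_bound[OF v(1)])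
  then show ?thesis
    using norm_cls_le_iff[OF convolution_elements[OF v(1)]] v
    by (simp add: class_convolution_cls)
qed

lemma class_convolution_one: "class_convolution a 1 = 1"
  using class_convolution_cls[OF Linf_const[of 1]] cls_const[of 1, where 'a='a]
  by (simp add: convolution_const)

end

section \<open>Differential equations in Banach spaces\<close>

text \<open>The integral is a limit of Riemann sums, which lie in the subspace.\<close>

lemma integral_in_closed_subspace:
  fixes f :: "real \<Rightarrow> 'b::banach"
  assumes X: "subspace X" "closed X" and f: "f integrable_on {a..b}" "\<And>s. s \<in> {a..b} \<Longrightarrow> f s \<in> X"
  shows "integral {a..b} f \<in> X"
proof -
  have "integral {a..b} f \<in> closure X"
    unfolding closure_approachable
  proof (intro allI impI)
    fix e :: real assume "0 < e"
    have "(f has_integral integral {a..b} f) {a..b}" using f(1) by (rule integrable_integral)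
    then obtain \<gamma> where \<gamma>: "gauge \<gamma>" and *: "\<And>\<D>. \<D> tagged_division_of {a..b} \<Longrightarrow> \<gamma> fine \<D> \<Longrightarrow>
        norm ((\<Sum>(x, k)\<in>\<D>. measure lborel k *\<^sub>R f x) - integral {a..b} f) < e"
      using \<open>0 < e\<close> unfolding has_integral_real by meson
    obtain \<D> where \<D>: "\<D> tagged_division_of {a..b}" "\<gamma> fine \<D>"
      using fine_division_exists_real[OF \<gamma>] by blast
    have "(\<Sum>(x, k)\<in>\<D>. measure lborel k *\<^sub>R f x) \<in> X"
    proof (rule subspace_sum[OF X(1)], clarify)
      fix x k assume "(x, k) \<in> \<D>"
      then have "x \<in> {a..b}" using \<D>(1) by (meson subsetD tagged_division_ofD(2,3))
      then show "measure lborel k *\<^sub>R f x \<in> X" using X(1) f(2) by (simp add: subspace_scale)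
    qed
    with *[OF \<D>] show "\<exists>y\<in>X. dist y (integral {a..b} f) < e" by (auto simp: dist_norm)
  qed
  then show ?thesis using X(2) by simp
qed

lemma power_fact_has_derivative:
  "((\<lambda>s. s ^ Suc n / fact (Suc n)) has_vector_derivative s ^ n / fact n) (at (s::real) within A)"
  unfolding has_real_derivative_iff_has_vector_derivative[symmetric]
  by (auto intro!: derivative_eq_intros simp: field_simps simp del: power_Suc of_nat_Suc)

lemma integral_power_fact:
  assumes "0 \<le> (t::real)"
  shows "((\<lambda>s. s ^ n / fact n) has_integral (t ^ Suc n / fact (Suc n))) {0..t}"
proof -
  show ?thesis
    using fundamental_theorem_of_calculus[OF assms power_fact_has_derivative[of n]]
    by (simp del: power_Suc fact_Suc)
qed

text \<open>
  The Picard iteration in time-dependent closed sets \<open>S t\<close> on which the right-hand side is Lipschitz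
  and which the Picard operator leaves invariant. The \<open>n\<close>-th increment is at most
  \<open>C (L t)^n / n!\<close>, so that there is no restriction on the length of the interval.
\<close>

lemma picard_lindelof_invariant:
  fixes f :: "real \<Rightarrow> 'b::banach \<Rightarrow> 'b" and S :: "real \<Rightarrow> 'b set"
  assumes "0 \<le> T" and "0 \<le> L"
    and closed: "\<And>t. t \<in> {0..T} \<Longrightarrow> closed (S t)"
    and start: "\<And>t. t \<in> {0..T} \<Longrightarrow> x0 \<in> S t"
    and cont: "\<And>v. continuous_on {0..T} v \<Longrightarrow> (\<And>t. t \<in> {0..T} \<Longrightarrow> v t \<in> S t) \<Longrightarrow>
                 continuous_on {0..T} (\<lambda>t. f t (v t))"
    and lip: "\<And>t v w. t \<in> {0..T} \<Longrightarrow> v \<in> S t \<Longrightarrow> w \<in> S t \<Longrightarrow> norm (f t v - f t w) \<le> L * norm (v - w)"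
    and inv: "\<And>v t. continuous_on {0..T} v \<Longrightarrow> (\<And>t. t \<in> {0..T} \<Longrightarrow> v t \<in> S t) \<Longrightarrow> t \<in> {0..T} \<Longrightarrow>
                 x0 + integral {0..t} (\<lambda>s. f s (v s)) \<in> S t"
  obtains u where "u 0 = x0" "\<And>t. t \<in> {0..T} \<Longrightarrow> u t \<in> S t"
    "\<And>t. t \<in> {0..T} \<Longrightarrow> (u has_vector_derivative f t (u t)) (at t within {0..T})"
proof -
  define P where "P v t = x0 + integral {0..t} (\<lambda>s. f s (v s))" for v t
  define adm where "adm v \<longleftrightarrow> continuous_on {0..T} v \<and> (\<forall>t\<in>{0..T}. v t \<in> S t)" for v
  have adm_cont: "continuous_on {0..T} (\<lambda>t. f t (v t))" if "adm v" for v
    using that cont by (auto simp: adm_def)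
  have int: "(\<lambda>s. f s (v s)) integrable_on {0..t}" if "adm v" "t \<in> {0..T}" for v t
    using that by (intro integrable_continuous_real continuous_on_subset[OF adm_cont]) auto
  have deriv: "(P v has_vector_derivative f t (v t)) (at t within {0..T})"
    if "adm v" "t \<in> {0..T}" for v t
    unfolding P_def using integral_has_vector_derivative[OF adm_cont[OF that(1)] that(2)]
    by (auto intro!: derivative_eq_intros)
  have adm_P: "adm (P v)" if "adm v" for v
    unfolding adm_def
  proof
    show "continuous_on {0..T} (P v)"
      unfolding continuous_on_eq_continuous_within
      using has_vector_derivative_continuous[OF deriv[OF that]] by blast
    show "\<forall>t\<in>{0..T}. P v t \<in> S t" using that inv unfolding adm_def P_def by blast
  qed
  have P_diff: "norm (P v t - P w t) \<le> integral {0..t} g"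
    if "adm v" "adm w" "t \<in> {0..T}" "g integrable_on {0..t}"
      "\<And>s. s \<in> {0..t} \<Longrightarrow> L * norm (v s - w s) \<le> g s" for v w t g
  proof -
    have "P v t - P w t = integral {0..t} (\<lambda>s. f s (v s) - f s (w s))"
      unfolding P_def using integral_diff[OF int int, of v t w] that by simp
    also have "norm \<dots> \<le> integral {0..t} g"
    proof (rule integral_norm_bound_integral)
      show "(\<lambda>s. f s (v s) - f s (w s)) integrable_on {0..t}"
        using that by (intro integrable_diff int)
      fix s assume "s \<in> {0..t}"
      then have "norm (f s (v s) - f s (w s)) \<le> L * norm (v s - w s)"
        using that(1-3) by (intro lip) (auto simp: adm_def)
      also have "\<dots> \<le> g s" using that(5) \<open>s \<in> {0..t}\<close> by blast
      finally show "norm (f s (v s) - f s (w s)) \<le> g s" .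
    qed fact
    finally show ?thesis .
  qed
  define u where "u n = (P ^^ n) (\<lambda>_. x0)" for n
  have u_Suc: "u (Suc n) = P (u n)" for n by (simp add: u_def)
  have adm_u: "adm (u n)" for n
  proof (induction n)
    case 0
    then show ?case using start by (simp add: u_def adm_def)
  qed (simp add: u_Suc adm_P)
  obtain C where C: "\<And>t. t \<in> {0..T} \<Longrightarrow> norm (u 1 t - u 0 t) \<le> C"
  proof -
    have "continuous_on {0..T} (\<lambda>t. u 1 t - u 0 t)"
      using adm_u[of 1] adm_u[of 0] unfolding adm_def by (auto intro: continuous_on_diff)
    then have "bounded ((\<lambda>t. u 1 t - u 0 t) ` {0..T})"
      using compact_continuous_image compact_imp_bounded compact_Icc by blast
    then obtain C where "\<forall>y\<in>(\<lambda>t. u 1 t - u 0 t) ` {0..T}. norm y \<le> C" unfolding bounded_iff ..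
    then show ?thesis using that by blast
  qed
  have step: "norm (u (Suc n) t - u n t) \<le> C * L ^ n * (t ^ n / fact n)" if "t \<in> {0..T}" for n t
    using that
  proof (induction n arbitrary: t)
    case 0
    then show ?case using C by simp
  next
    case (Suc n)
    have hi: "((\<lambda>s. L * (C * L ^ n * (s ^ n / fact n))) has_integral
        L * (C * L ^ n * (t ^ Suc n / fact (Suc n)))) {0..t}"
      using Suc.prems by (intro has_integral_mult_right integral_power_fact) auto
    have "norm (P (u (Suc n)) t - P (u n) t) \<le> integral {0..t} (\<lambda>s. L * (C * L ^ n * (s ^ n / fact n)))"
      using Suc hi \<open>0 \<le> L\<close> by (intro P_diff adm_u mult_left_mono Suc.IH) (auto intro: has_integral_integrable)
    also have "\<dots> = C * L ^ Suc n * (t ^ Suc n / fact (Suc n))"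
      using integral_unique[OF hi] by (simp add: mult_ac)
    finally show ?case by (simp only: u_Suc)
  qed
  have "uniform_limit {0..T} (\<lambda>n t. \<Sum>i<n. u (Suc i) t - u i t)
          (\<lambda>t. \<Sum>i. u (Suc i) t - u i t) sequentially"
  proof (rule Weierstrass_m_test)
    have "0 \<le> C" using C[of 0] \<open>0 \<le> T\<close> by (meson atLeastAtMost_iff norm_ge_zero order_refl order_trans)
    show "norm (u (Suc n) t - u n t) \<le> C * ((L * T) ^ n /\<^sub>R fact n)" if "t \<in> {0..T}" for n t
    proof -
      have "norm (u (Suc n) t - u n t) \<le> C * L ^ n * (t ^ n / fact n)" by (rule step[OF that])
      also have "\<dots> \<le> C * L ^ n * (T ^ n / fact n)"
        using that \<open>0 \<le> C\<close> \<open>0 \<le> L\<close> by (intro mult_left_mono divide_right_mono power_mono) auto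
      finally show ?thesis by (simp add: power_mult_distrib divide_inverse mult_ac)
    qed
    show "summable (\<lambda>n. C * ((L * T) ^ n /\<^sub>R fact n))"
      by (intro summable_mult summable_exp_generic)
  qed
  moreover have "(\<Sum>i<n. u (Suc i) t - u i t) = u n t - x0" for n t
    using sum_lessThan_telescope[of "\<lambda>i. u i t" n] by (simp add: u_def)
  ultimately have "uniform_limit {0..T} (\<lambda>n t. (u n t - x0) + x0)
      (\<lambda>t. (\<Sum>i. u (Suc i) t - u i t) + x0) sequentially"
    by (intro uniform_limit_intros) simp
  then obtain U where U: "uniform_limit {0..T} u U sequentially" by auto
  have U_lim: "(\<lambda>n. u n t) \<longlonglongrightarrow> U t" if "t \<in> {0..T}" for t
    using tendsto_uniform_limitI[OF U that] .
  have adm_U: "adm U"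
    unfolding adm_def
  proof
    show "continuous_on {0..T} U"
      using adm_u by (intro uniform_limit_theorem[OF _ U]) (auto simp: adm_def)
    show "\<forall>t\<in>{0..T}. U t \<in> S t"
      using closed_sequentially[OF closed _ U_lim] adm_u by (auto simp: adm_def)
  qed
  have U_fixed: "U t = P U t" if t: "t \<in> {0..T}" for t
  proof -
    have "(\<lambda>n. u (Suc n) t) \<longlonglongrightarrow> P U t"
    proof (rule metric_LIMSEQ_I)
      fix e :: real assume "0 < e"
      define d where "d = e / (L * T + 1)"
      have "0 < L * T + 1" using \<open>0 \<le> L\<close> \<open>0 \<le> T\<close> by (simp add: add_nonneg_pos)
      then have "d * (L * T + 1) = e" "0 < d" using \<open>0 < e\<close> by (auto simp: d_def)
      then have "L * d * T + d = e" by (simp add: algebra_simps)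
      from \<open>0 < d\<close> obtain N where N: "\<And>n s. N \<le> n \<Longrightarrow> s \<in> {0..T} \<Longrightarrow> norm (u n s - U s) < d"
        using U unfolding uniform_limit_iff eventually_sequentially dist_norm by meson
      have "dist (u (Suc n) t) (P U t) < e" if "N \<le> n" for n
      proof -
        have "norm (P (u n) t - P U t) \<le> integral {0..t} (\<lambda>_. L * d)"
          using t \<open>0 \<le> L\<close> N[OF that]
          by (intro P_diff adm_u adm_U mult_left_mono) (auto intro: less_imp_le)
        also have "\<dots> = L * d * t" using t by simp
        also have "\<dots> \<le> L * d * T" using t \<open>0 \<le> L\<close> \<open>0 < d\<close> by (intro mult_left_mono) auto
        finally show ?thesis using \<open>0 < d\<close> \<open>L * d * T + d = e\<close> by (simp add: dist_norm u_Suc)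
      qed
      then show "\<exists>N. \<forall>n\<ge>N. dist (u (Suc n) t) (P U t) < e" by blast
    qed
    moreover have "(\<lambda>n. u (Suc n) t) \<longlonglongrightarrow> U t" using U_lim[OF t] by (rule LIMSEQ_Suc)
    ultimately show ?thesis by (rule LIMSEQ_unique[symmetric])
  qed
  show thesis
  proof
    show "P U 0 = x0" by (simp add: P_def)
    show "P U t \<in> S t" if "t \<in> {0..T}" for t using adm_P[OF adm_U] that by (simp add: adm_def)
    show "(P U has_vector_derivative f t (P U t)) (at t within {0..T})" if "t \<in> {0..T}" for t
      using deriv[OF adm_U that] U_fixed[OF that] by simp
  qed
qed

text \<open>
  Gronwall's lemma with zero initial value: \<open>norm (w t) \<le> C (L t)^n / n!\<close> follows by induction on \<open>n\<close>
  from the mean value inequality. The derivative at 0 is not needed.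
\<close>

lemma gronwall_zero:
  fixes w :: "real \<Rightarrow> 'b::real_normed_vector"
  assumes cont: "continuous_on {0..T} w" and w0: "w 0 = 0"
    and deriv: "\<And>t. t \<in> {0<..T} \<Longrightarrow> (w has_vector_derivative w' t) (at t within {0<..T})"
    and bound: "\<And>t. t \<in> {0<..T} \<Longrightarrow> norm (w' t) \<le> L * norm (w t)"
    and "0 \<le> L" and t: "t \<in> {0..T}"
  shows "w t = 0"
proof -
  have "bounded (w ` {0..T})"
    using cont compact_continuous_image compact_imp_bounded compact_Icc by blast
  then obtain C where "\<forall>y\<in>w ` {0..T}. norm y \<le> C" unfolding bounded_iff ..
  then have C: "\<And>t. t \<in> {0..T} \<Longrightarrow> norm (w t) \<le> C" by blast
  have step: "norm (w t) \<le> C * L ^ n * (t ^ n / fact n)" if "t \<in> {0..T}" for n t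
    using that
  proof (induction n arbitrary: t)
    case 0
    then show ?case using C by simp
  next
    case (Suc n)
    show ?case
    proof (cases "t = 0")
      case False
      let ?\<phi> = "\<lambda>s. C * L ^ Suc n * (s ^ Suc n / fact (Suc n))"
      have "norm (w t - w 0) \<le> ?\<phi> t - ?\<phi> 0"
      proof (rule differentiable_bound_general)
        show "0 < t" using False Suc.prems by simp
        show "continuous_on {0..t} w" using cont Suc.prems by (auto elim: continuous_on_subset)
        show "continuous_on {0..t} ?\<phi>" by (intro continuous_intros) simp
        fix s assume s: "0 < s" "s < t"
        then have sT: "s \<in> {0<..T}" using Suc.prems by auto
        have "s \<in> interior {0<..T}" using s Suc.prems by simp
        with deriv[OF sT] show "(w has_vector_derivative w' s) (at s)"
          by (metis at_within_interior)
        show "(?\<phi> has_vector_derivative C * L ^ Suc n * (s ^ n / fact n)) (at s)"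
          by (rule has_vector_derivative_mult_right[OF power_fact_has_derivative])
        have "norm (w' s) \<le> L * norm (w s)" by (rule bound[OF sT])
        also have "\<dots> \<le> L * (C * L ^ n * (s ^ n / fact n))"
          using sT \<open>0 \<le> L\<close> by (intro mult_left_mono Suc.IH) auto
        finally show "norm (w' s) \<le> C * L ^ Suc n * (s ^ n / fact n)" by (simp add: mult_ac)
      qed
      then show ?thesis by (simp add: w0)
    qed (use w0 in simp)
  qed
  have "(\<lambda>n. C * ((L * t) ^ n /\<^sub>R fact n)) \<longlonglongrightarrow> 0"
    by (intro summable_LIMSEQ_zero summable_mult summable_exp_generic)
  then have "(\<lambda>n. C * L ^ n * (t ^ n / fact n)) \<longlonglongrightarrow> 0"
    by (simp add: power_mult_distrib divide_inverse mult_ac)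
  then have "norm (w t) \<le> 0" using step[OF t] by (intro LIMSEQ_le_const) auto
  then show ?thesis by simp
qed

section \<open>Existence and uniqueness for the abstract equation\<close>

lemma norm_mult_diff_le:
  fixes V W P Q :: "'b::real_normed_algebra"
  assumes "norm P \<le> M" "norm W \<le> \<rho>" "norm (P - Q) \<le> K * norm (V - W)" "0 \<le> \<rho>"
  shows "norm (V * P - W * Q) \<le> (M + \<rho> * K) * norm (V - W)"
proof -
  have "V * P - W * Q = (V - W) * P + W * (P - Q)" by (simp add: algebra_simps)
  also have "norm \<dots> \<le> norm (V - W) * norm P + norm W * norm (P - Q)"
    by (intro order_trans[OF norm_triangle_ineq] add_mono norm_mult_ineq)
  also have "\<dots> \<le> norm (V - W) * M + \<rho> * (K * norm (V - W))"
    using assms by (intro add_mono mult_mono mult_left_mono) auto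
  finally show ?thesis by (simp add: algebra_simps)
qed

text \<open>
  The data of the equation, in a Banach algebra with unit: \<open>X\<close> is the space, \<open>A\<close> the convolution
  and \<open>G\<close> the competition operator. As \<open>order_interval\<close> is defined by the norm alone, \<open>G_nonneg\<close> is the
  form in which \<open>G\<close> preserves nonnegativity: a nonnegative element \<open>V\<close> lies between 0 and its norm.
  The assumption \<open>order_interval_mult\<close> holds for algebras of real functions but not in general: in the
  complex numbers \<open>order_interval 1\<close> is a disc, which contains \<open>(1 + i)/2\<close> but not its square.
\<close>

locale abstract_logistic =
  fixes X :: "'b::{banach, real_normed_algebra_1} set" and A G :: "'b \<Rightarrow> 'b"
    and \<nu> m \<kappa> :: real
  assumes subspace_X: "subspace X" and closed_X: "closed X"
    and mult_X: "\<And>V W. V \<in> X \<Longrightarrow> W \<in> X \<Longrightarrow> V * W \<in> X"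
    and order_interval_mult:
      "\<And>(V::'b) W r s. V \<in> order_interval r \<Longrightarrow> W \<in> order_interval s \<Longrightarrow> V * W \<in> order_interval (r * s)"
    and linear_A: "linear A" and norm_A: "\<And>V. norm (A V) \<le> norm V" and A_one: "A 1 = 1"
    and A_X: "\<And>V. V \<in> X \<Longrightarrow> A V \<in> X"
    and G_X: "\<And>V. V \<in> X \<Longrightarrow> G V \<in> X"
    and G_nonneg: "\<And>V r. V \<in> X \<Longrightarrow> V \<in> order_interval r \<Longrightarrow> G V \<in> order_interval (norm (G V))"
    and G_lipschitz: "\<And>V W r. 0 < r \<Longrightarrow> V \<in> X \<inter> order_interval r \<Longrightarrow> W \<in> X \<inter> order_interval r \<Longrightarrow>
      norm (G V - G W) \<le> exp (\<kappa> * r) * norm (V - W)"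
    and nonneg: "0 \<le> \<nu>" "0 \<le> m"
begin

text \<open>The right-hand side of the equation.\<close>

definition rhs :: "'b \<Rightarrow> 'b" where
  "rhs V = \<nu> *\<^sub>R A V - m *\<^sub>R V - V * G V"

text \<open>A bound for \<open>G\<close> on the order interval from 0 to \<open>r\<close>, by comparison with \<open>G 0\<close>.\<close>

definition G_bound :: "real \<Rightarrow> real" where
  "G_bound r = norm (G 0) + exp (\<kappa> * r) * r"

lemma G_in_order_interval:
  assumes "0 < r" "V \<in> X \<inter> order_interval r"
  shows "G V \<in> order_interval (G_bound r)"
proof -
  have 0: "0 \<in> X \<inter> order_interval r"
    using assms subspace_X by (auto intro: zero_in_order_interval subspace_0)
  have "norm (G V) \<le> norm (G 0) + norm (G V - G 0)" by (rule norm_triangle_sub)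
  also have "\<dots> \<le> norm (G 0) + exp (\<kappa> * r) * norm V"
    using G_lipschitz[OF assms 0] by simp
  also have "\<dots> \<le> G_bound r"
    using order_interval_norm_le assms unfolding G_bound_def by auto
  finally show ?thesis using G_nonneg assms order_interval_mono by blast
qed

lemma norm_G_le: "0 < r \<Longrightarrow> V \<in> X \<inter> order_interval r \<Longrightarrow> norm (G V) \<le> G_bound r"
  by (rule order_interval_norm_le[OF G_in_order_interval])

text \<open>A linear contraction that fixes the unit preserves the balls \<open>order_interval r\<close>.\<close>

lemma A_order_interval:
  assumes "V \<in> order_interval r"
  shows "A V \<in> order_interval r"
proof -
  have "A (of_real (r / 2)) = of_real (r / 2)"
    using linear_A by (simp add: of_real_def linear_scale A_one del: scaleR_half_double)
  then have "A V - of_real (r / 2) = A (V - of_real (r / 2))"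
    using linear_A by (simp add: linear_diff)
  then show ?thesis
    using assms norm_A order_trans unfolding order_interval_iff by metis
qed

lemma continuous_G: "0 < r \<Longrightarrow> continuous_on (X \<inter> order_interval r) G"
  by (rule lipschitz_on_continuous_on[OF lipschitz_onI[where L="exp (\<kappa> * r)"]])
    (auto simp: dist_norm intro: G_lipschitz)

lemma bounded_linear_A: "bounded_linear A"
  using linear_A norm_A by (auto intro!: bounded_linear_intro[of A 1] simp: linear_add linear_scale)

lemma rhs_X: "V \<in> X \<Longrightarrow> rhs V \<in> X"
  unfolding rhs_def using subspace_X
  by (intro subspace_diff subspace_scale mult_X A_X G_X)

lemma continuous_rhs: "0 < r \<Longrightarrow> continuous_on (X \<inter> order_interval r) rhs"
  unfolding rhs_def
  by (intro continuous_intros continuous_G bounded_linear.continuous_on[OF bounded_linear_A])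

lemma rhs_lipschitz:
  assumes "0 < r" "V \<in> X \<inter> order_interval r" "W \<in> X \<inter> order_interval r"
  shows "norm (rhs V - rhs W) \<le> (\<nu> + m + (G_bound r + r * exp (\<kappa> * r))) * norm (V - W)"
proof -
  have "norm (V * G V - W * G W) \<le> (G_bound r + r * exp (\<kappa> * r)) * norm (V - W)"
    using assms order_interval_norm_le[of W r]
    by (intro norm_mult_diff_le norm_G_le[OF assms(1,2)] G_lipschitz) auto
  moreover have "rhs V - rhs W = \<nu> *\<^sub>R A (V - W) - m *\<^sub>R (V - W) - (V * G V - W * G W)"
    using linear_A by (simp add: rhs_def linear_diff algebra_simps)
  moreover have "norm (\<nu> *\<^sub>R A (V - W)) \<le> \<nu> * norm (V - W)"
    using nonneg norm_A by (simp add: mult_left_mono)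
  moreover have "norm (m *\<^sub>R (V - W)) = m * norm (V - W)" using nonneg by simp
  ultimately show ?thesis
    using norm_triangle_ineq4[of "\<nu> *\<^sub>R A (V - W) - m *\<^sub>R (V - W)" "V * G V - W * G W"]
      norm_triangle_ineq4[of "\<nu> *\<^sub>R A (V - W)" "m *\<^sub>R (V - W)"]
    unfolding distrib_right[of _ _ "norm (V - W)"] by (simp only:)
qed

lemma solution_unique:
  assumes U: "continuous_on {0..T} U" "\<And>t. t \<in> {0..T} \<Longrightarrow> U t \<in> X \<inter> order_interval r"
    "\<And>t. t \<in> {0<..T} \<Longrightarrow> (U has_vector_derivative rhs (U t)) (at t within {0<..T})"
    and W: "continuous_on {0..T} W" "\<And>t. t \<in> {0..T} \<Longrightarrow> W t \<in> X \<inter> order_interval r"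
    "\<And>t. t \<in> {0<..T} \<Longrightarrow> (W has_vector_derivative rhs (W t)) (at t within {0<..T})"
    and "U 0 = W 0" "0 < r" "t \<in> {0..T}"
  shows "U t = W t"
proof -
  have "U t - W t = 0"
  proof (rule gronwall_zero[where w="\<lambda>t. U t - W t" and w'="\<lambda>t. rhs (U t) - rhs (W t)"])
    show "0 \<le> \<nu> + m + (G_bound r + r * exp (\<kappa> * r))"
      using nonneg \<open>0 < r\<close> by (simp add: G_bound_def)
    show "norm (rhs (U s) - rhs (W s)) \<le>
        (\<nu> + m + (G_bound r + r * exp (\<kappa> * r))) * norm (U s - W s)" if "s \<in> {0<..T}" for s
      using that U(2)[of s] W(2)[of s] by (intro rhs_lipschitz \<open>0 < r\<close>) auto
  qed (use assms in \<open>auto intro!: continuous_intros has_vector_derivative_diff\<close>)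
  then show ?thesis by simp
qed

text \<open>
  Let \<open>M\<close> bound \<open>G\<close> on the order interval up to \<open>R = c exp (\<nu> T)\<close>. The function
  \<open>V t = exp ((m + M) t) U t\<close> solves \<open>V' = \<nu> A V + V * (M - G (exp (- (m + M) t) V))\<close>, whose right-hand
  side lies between 0 and \<open>(\<nu> + M) \<rho> t\<close> if \<open>V\<close> lies between 0 and \<open>\<rho> t = c exp ((\<nu> + M) t)\<close>.
  Since \<open>\<rho>' = (\<nu> + M) \<rho>\<close>, the Picard operator maps these order intervals into themselves.
\<close>

lemma solution_exists:
  assumes u0: "u0 \<in> X \<inter> order_interval c" and "0 < c" "0 \<le> T"
  obtains U where "U 0 = u0" "\<And>t. t \<in> {0..T} \<Longrightarrow> U t \<in> X \<inter> order_interval (c * exp (\<nu> * T))"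
    "\<And>t. t \<in> {0..T} \<Longrightarrow> (U has_vector_derivative rhs (U t)) (at t within {0..T})"
proof -
  define R where "R = c * exp (\<nu> * T)"
  define M where "M = G_bound R"
  define \<rho> where "\<rho> t = c * exp ((\<nu> + M) * t)" for t
  define f where "f t V = \<nu> *\<^sub>R A V + V * (of_real M - G (exp (- (m + M) * t) *\<^sub>R V))" for t V
  define S where "S t = X \<inter> order_interval (\<rho> t)" for t
  have "0 < R" using \<open>0 < c\<close> by (simp add: R_def)
  then have "0 \<le> M" by (simp add: M_def G_bound_def)
  have \<rho>_pos: "0 < \<rho> t" for t using \<open>0 < c\<close> by (simp add: \<rho>_def)
  have \<rho>_le: "\<rho> t \<le> \<rho> T" if "t \<in> {0..T}" for t
    using that \<open>0 < c\<close> nonneg \<open>0 \<le> M\<close> by (auto simp: \<rho>_def intro!: mult_left_mono)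
  \<comment> \<open>The argument of \<open>G\<close> stays where \<open>M\<close> bounds \<open>G\<close>.\<close>
  have damped: "exp (- (m + M) * t) *\<^sub>R V \<in> X \<inter> order_interval R" if "t \<in> {0..T}" "V \<in> S t" for t V
  proof -
    have "exp (- (m + M) * t) * \<rho> t = c * exp ((\<nu> - m) * t)"
      by (simp add: \<rho>_def exp_add[symmetric] algebra_simps)
    also have "(\<nu> - m) * t \<le> \<nu> * T"
      using that nonneg by (intro mult_mono) auto
    then have "c * exp ((\<nu> - m) * t) \<le> R" using \<open>0 < c\<close> by (simp add: R_def)
    finally have "exp (- (m + M) * t) * \<rho> t \<le> R" .
    then show ?thesis
      using order_interval_scale[of V "\<rho> t" "exp (- (m + M) * t)"] that subspace_X order_interval_mono
      by (auto simp: S_def subspace_scale)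
  qed
  have f_mem: "f t V \<in> X \<inter> order_interval ((\<nu> + M) * \<rho> t)" if t: "t \<in> {0..T}" and V: "V \<in> S t" for t V
  proof
    let ?P = "G (exp (- (m + M) * t) *\<^sub>R V)"
    have P: "?P \<in> X" using damped[OF t V] G_X by simp
    have VX: "V \<in> X" "V \<in> order_interval (\<rho> t)" using V by (auto simp: S_def)
    have "V * (of_real M - ?P) = M *\<^sub>R V - V * ?P"
      by (simp add: right_diff_distrib of_real_def)
    then show "f t V \<in> X"
      unfolding f_def using subspace_X VX P
      by (auto intro!: subspace_add subspace_diff subspace_scale mult_X A_X)
    have "of_real M - ?P \<in> order_interval M"
      unfolding M_def using \<open>0 < R\<close> damped[OF t V, unfolded M_def]
      by (intro order_interval_compl G_in_order_interval)
    then have "V * (of_real M - ?P) \<in> order_interval (\<rho> t * M)"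
      by (rule order_interval_mult[OF VX(2)])
    then have "f t V \<in> order_interval (\<nu> * \<rho> t + \<rho> t * M)"
      unfolding f_def using nonneg VX
      by (intro order_interval_add order_interval_scale A_order_interval)
    then show "f t V \<in> order_interval ((\<nu> + M) * \<rho> t)" by (simp add: algebra_simps)
  qed
  have f_cont: "continuous_on {0..T} (\<lambda>t. f t (v t))"
    if v: "continuous_on {0..T} v" "\<And>t. t \<in> {0..T} \<Longrightarrow> v t \<in> S t" for v
  proof -
    have "continuous_on {0..T} (\<lambda>t. G (exp (- (m + M) * t) *\<^sub>R v t))"
      using damped v by (intro continuous_on_compose2[OF continuous_G[OF \<open>0 < R\<close>]])
        (auto intro!: continuous_intros)
    then show ?thesis
      unfolding f_def using v
      by (intro continuous_intros bounded_linear.continuous_on[OF bounded_linear_A])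
  qed
  have \<rho>_integral: "((\<lambda>s. (\<nu> + M) * \<rho> s) has_integral (\<rho> t - c)) {0..t}" if "t \<in> {0..T}" for t
  proof -
    have "(\<rho> has_vector_derivative (\<nu> + M) * \<rho> s) (at s within {0..t})" for s
      unfolding has_real_derivative_iff_has_vector_derivative[symmetric] \<rho>_def
      by (auto intro!: derivative_eq_intros)
    moreover have "\<rho> 0 = c" by (simp add: \<rho>_def)
    ultimately show ?thesis
      using fundamental_theorem_of_calculus[of 0 t \<rho> "\<lambda>s. (\<nu> + M) * \<rho> s"] that by simp
  qed
  let ?L = "\<nu> + M + (M + \<rho> T * exp (\<kappa> * R))"
  obtain V where V: "V 0 = u0" "\<And>t. t \<in> {0..T} \<Longrightarrow> V t \<in> S t"
    "\<And>t. t \<in> {0..T} \<Longrightarrow> (V has_vector_derivative f t (V t)) (at t within {0..T})"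
  proof (rule picard_lindelof_invariant[of T ?L S u0 f])
    show "0 \<le> T" by fact
    show "0 \<le> ?L" using nonneg \<open>0 \<le> M\<close> \<rho>_pos[of T] by simp
    show "closed (S t)" for t unfolding S_def order_interval_def by (intro closed_Int closed_X closed_cball)
    show "u0 \<in> S t" if "t \<in> {0..T}" for t
    proof -
      have "c * 1 \<le> \<rho> t"
        unfolding \<rho>_def using \<open>0 < c\<close> nonneg \<open>0 \<le> M\<close> that by (intro mult_left_mono) auto
      then show ?thesis using u0 order_interval_mono by (auto simp: S_def)
    qed
    show "continuous_on {0..T} (\<lambda>t. f t (v t))"
      if "continuous_on {0..T} v" "\<And>t. t \<in> {0..T} \<Longrightarrow> v t \<in> S t" for v using that by (rule f_cont)
    show "norm (f t v - f t w) \<le> ?L * norm (v - w)"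
      if t: "t \<in> {0..T}" and v: "v \<in> S t" and w: "w \<in> S t" for t v w
    proof -
      let ?e = "exp (- (m + M) * t)"
      let ?P = "G (?e *\<^sub>R v)" and ?Q = "G (?e *\<^sub>R w)"
      have "norm (?P - ?Q) \<le> exp (\<kappa> * R) * norm (?e *\<^sub>R v - ?e *\<^sub>R w)"
        using damped[OF t v] damped[OF t w] by (intro G_lipschitz \<open>0 < R\<close>)
      also have "norm (?e *\<^sub>R v - ?e *\<^sub>R w) = ?e * norm (v - w)"
        by (simp flip: scaleR_diff_right)
      also have "\<dots> \<le> 1 * norm (v - w)"
      proof (rule mult_right_mono)
        have "0 \<le> (m + M) * t" using t nonneg \<open>0 \<le> M\<close> by (intro mult_nonneg_nonneg) auto
        then show "?e \<le> 1" by (simp only: exp_le_one_iff mult_minus_left neg_le_0_iff_le)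
      qed simp
      finally have PQ: "norm (?P - ?Q) \<le> exp (\<kappa> * R) * norm (v - w)" by simp
      have "norm (v * ?P - w * ?Q) \<le> (M + \<rho> T * exp (\<kappa> * R)) * norm (v - w)"
      proof (rule norm_mult_diff_le[OF _ _ PQ])
        show "norm ?P \<le> M" unfolding M_def
          using norm_G_le[OF \<open>0 < R\<close> damped[OF t v]] by (simp add: M_def)
        show "norm w \<le> \<rho> T"
          using order_interval_norm_le[of w "\<rho> t"] w \<rho>_le[OF t] by (auto simp: S_def)
        show "0 \<le> \<rho> T" using \<rho>_pos[of T] by simp
      qed
      moreover have "f t v - f t w = \<nu> *\<^sub>R A (v - w) + M *\<^sub>R (v - w) - (v * ?P - w * ?Q)"
        using linear_A by (simp add: f_def linear_diff right_diff_distrib of_real_def algebra_simps)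
      moreover have "norm (\<nu> *\<^sub>R A (v - w)) \<le> \<nu> * norm (v - w)"
        using nonneg norm_A by (simp add: mult_left_mono)
      moreover have "norm (M *\<^sub>R (v - w)) = M * norm (v - w)" using \<open>0 \<le> M\<close> by simp
      ultimately show ?thesis
        using norm_triangle_ineq4[of "\<nu> *\<^sub>R A (v - w) + M *\<^sub>R (v - w)" "v * ?P - w * ?Q"]
          norm_triangle_ineq[of "\<nu> *\<^sub>R A (v - w)" "M *\<^sub>R (v - w)"]
        unfolding distrib_right[of _ _ "norm (v - w)"] by (simp only:)
    qed
    show "u0 + integral {0..t} (\<lambda>s. f s (v s)) \<in> S t"
      if v: "continuous_on {0..T} v" "\<And>t. t \<in> {0..T} \<Longrightarrow> v t \<in> S t" and t: "t \<in> {0..T}" for v t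
    proof -
      have int: "(\<lambda>s. f s (v s)) integrable_on {0..t}"
        using t by (intro integrable_continuous_real continuous_on_subset[OF f_cont[OF v]]) auto
      have mem: "f s (v s) \<in> X \<inter> order_interval ((\<nu> + M) * \<rho> s)" if "s \<in> {0..t}" for s
        using that t by (intro f_mem v(2)) auto
      have "integral {0..t} (\<lambda>s. f s (v s)) \<in> order_interval (\<rho> t - c)"
        using mem by (intro order_interval_integral[OF int \<rho>_integral[OF t]]) auto
      then have "u0 + integral {0..t} (\<lambda>s. f s (v s)) \<in> order_interval (c + (\<rho> t - c))"
        using u0 by (intro order_interval_add) auto
      moreover have "integral {0..t} (\<lambda>s. f s (v s)) \<in> X"
        using mem by (intro integral_in_closed_subspace[OF subspace_X closed_X int]) auto
      ultimately show ?thesis using u0 subspace_X by (simp add: S_def subspace_add)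
    qed
  qed blast
  define U where "U t = exp (- (m + M) * t) *\<^sub>R V t" for t
  show thesis
  proof
    show "U 0 = u0" by (simp add: U_def V)
    show "U t \<in> X \<inter> order_interval (c * exp (\<nu> * T))" if "t \<in> {0..T}" for t
      using damped[OF that V(2)[OF that]] by (simp add: U_def R_def)
    show "(U has_vector_derivative rhs (U t)) (at t within {0..T})" if "t \<in> {0..T}" for t
    proof -
      let ?e = "exp (- (m + M) * t)"
      have "((\<lambda>t. exp (- (m + M) * t)) has_real_derivative - (m + M) * ?e) (at t within {0..T})"
        by (auto intro!: derivative_eq_intros)
      then have "(U has_vector_derivative ?e *\<^sub>R f t (V t) + (- (m + M) * ?e) *\<^sub>R V t) (at t within {0..T})"
        unfolding U_def using V(3)[OF that] by (rule has_vector_derivative_scaleR)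
      moreover have "?e *\<^sub>R f t (V t) + (- (m + M) * ?e) *\<^sub>R V t = rhs (U t)"
        using linear_A
        by (simp add: f_def rhs_def U_def linear_scale right_diff_distrib of_real_def algebra_simps)
      ultimately show ?thesis by simp
    qed
  qed
qed

text \<open>The solutions on bounded intervals are consistent by uniqueness, hence define a global one.\<close>

lemma solution_exists_global:
  assumes u0: "u0 \<in> X \<inter> order_interval c" and "0 < c"
  obtains U where "U 0 = u0"
    "\<And>t T. 0 \<le> t \<Longrightarrow> t \<le> T \<Longrightarrow> U t \<in> X \<inter> order_interval (c * exp (\<nu> * T))"
    "\<And>t. 0 \<le> t \<Longrightarrow> (U has_vector_derivative rhs (U t)) (at t within {0..})"
    "continuous_on {0..} (\<lambda>t. rhs (U t))"
proof -
  have "\<exists>U. U 0 = u0 \<and> (\<forall>t\<in>{0..T}. U t \<in> X \<inter> order_interval (c * exp (\<nu> * T)) \<and>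
      (U has_vector_derivative rhs (U t)) (at t within {0..T}))" if "0 \<le> T" for T
    using solution_exists[OF u0 \<open>0 < c\<close> that] by metis
  then obtain UU where UU: "\<And>T. 0 \<le> T \<Longrightarrow> UU T 0 = u0 \<and> (\<forall>t\<in>{0..T}. UU T t \<in> X \<inter> order_interval (c * exp (\<nu> * T)) \<and>
      (UU T has_vector_derivative rhs (UU T t)) (at t within {0..T}))"
    by metis
  then have init: "\<And>T. 0 \<le> T \<Longrightarrow> UU T 0 = u0"
    and mem: "\<And>T t. t \<in> {0..T} \<Longrightarrow> UU T t \<in> X \<inter> order_interval (c * exp (\<nu> * T))"
    and deriv: "\<And>T t. t \<in> {0..T} \<Longrightarrow> (UU T has_vector_derivative rhs (UU T t)) (at t within {0..T})"
    by auto
  have cont: "continuous_on {0..T} (UU T)" for T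
    unfolding continuous_on_eq_continuous_within
    using has_vector_derivative_continuous[OF deriv] by blast
  have agree: "UU S t = UU T t" if "S \<le> T" "t \<in> {0..S}" for S T t
  proof (rule solution_unique[where T=S])
    show "0 < c * exp (\<nu> * T)" using \<open>0 < c\<close> by simp
    show "UU S s \<in> X \<inter> order_interval (c * exp (\<nu> * T))" if "s \<in> {0..S}" for s
    proof -
      have "c * exp (\<nu> * S) \<le> c * exp (\<nu> * T)"
        using \<open>0 < c\<close> \<open>S \<le> T\<close> nonneg by (simp add: mult_left_mono)
      then show ?thesis using mem[OF that] order_interval_mono by blast
    qed
    show "UU T s \<in> X \<inter> order_interval (c * exp (\<nu> * T))" if "s \<in> {0..S}" for s
      using that \<open>S \<le> T\<close> by (intro mem) auto
    show "(UU S has_vector_derivative rhs (UU S s)) (at s within {0<..S})" if "s \<in> {0<..S}" for s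
      using that by (intro has_vector_derivative_within_subset[OF deriv]) auto
    show "(UU T has_vector_derivative rhs (UU T s)) (at s within {0<..S})" if "s \<in> {0<..S}" for s
      using that \<open>S \<le> T\<close> by (intro has_vector_derivative_within_subset[OF deriv]) auto
    show "continuous_on {0..S} (UU S)" by (rule cont)
    show "continuous_on {0..S} (UU T)"
      using \<open>S \<le> T\<close> by (intro continuous_on_subset[OF cont]) auto
  qed (use that init in auto)
  \<comment> \<open>At time \<open>t\<close> a solution on a longer interval is used, to have a neighbourhood of \<open>t\<close> in \<open>{0..}\<close>.\<close>
  define U where "U t = UU (t + 1) t" for t
  have U_eq: "U t = UU T t" if "t \<in> {0..T}" for t T
  proof (cases "t + 1 \<le> T")
    case True
    have "t \<in> {0..t + 1}" using that by simp
    from agree[OF True this] show ?thesis by (simp only: U_def)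
  next
    case False
    then have "T \<le> t + 1" by simp
    from agree[OF this that] show ?thesis by (simp only: U_def)
  qed
  have nhd: "at t within {0..t + 1} = at t within {0..}" if "0 \<le> t" for t :: real
    by (rule at_within_nhd[of t "{..<t + 1}"]) auto
  show thesis
  proof
    show "U 0 = u0" by (simp add: U_def init)
    show U_mem: "U t \<in> X \<inter> order_interval (c * exp (\<nu> * T))" if "0 \<le> t" "t \<le> T" for t T
      using U_eq[of t T] mem[of t T] that by simp
    show "(U has_vector_derivative rhs (U t)) (at t within {0..})" if "0 \<le> t" for t
    proof -
      have "(U has_vector_derivative rhs (U t)) (at t within {0..t + 1})"
        using deriv[of t "t + 1"] that U_eq[of _ "t + 1"]
        by (intro has_vector_derivative_transform[of t "{0..t + 1}" U "UU (t + 1)"]) auto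
      then show ?thesis using nhd[OF that] by simp
    qed
    show "continuous_on {0..} (\<lambda>t. rhs (U t))"
      unfolding continuous_on_eq_continuous_within
    proof
      fix t :: real assume t: "t \<in> {0..}"
      have "continuous_on {0..t + 1} U"
        using cont[of "t + 1"] U_eq[of _ "t + 1"] by (metis (no_types, lifting) continuous_on_cong)
      then have "continuous_on {0..t + 1} (\<lambda>s. rhs (U s))"
        using \<open>0 < c\<close> U_mem[of _ "t + 1"]
        by (intro continuous_on_compose2[OF continuous_rhs[of "c * exp (\<nu> * (t + 1))"]]) auto
      then have "continuous (at t within {0..t + 1}) (\<lambda>s. rhs (U s))"
        using t by (simp add: continuous_on_eq_continuous_within)
      moreover have "0 \<le> t" using t by simp
      ultimately show "continuous (at t within {0..}) (\<lambda>t. rhs (U t))" by (simp only: nhd)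
    qed
  qed
qed

end

section \<open>Classical solutions as curves of classes\<close>

lemma cls_diff_elements:
  fixes v w :: "'a::euclidean_space \<Rightarrow> real"
  assumes "v \<in> elements E" "w \<in> elements E"
  shows "cls (\<lambda>x. v x - w x) = cls v - cls w"
  using assms by (intro cls_diff elements_Linf)

text \<open>
  Continuity and differentiability of a curve in \<open>E\<close> are those of the curve of its classes in the
  Banach space of classes.
\<close>

lemma cont_in_iff:
  fixes u :: "real \<Rightarrow> 'a::euclidean_space \<Rightarrow> real"
  shows "cont_in E J u \<longleftrightarrow> (\<forall>t\<in>J. u t \<in> elements E) \<and> continuous_on J (\<lambda>t. cls (u t))"
proof -
  have "((\<lambda>s. norm_in E (\<lambda>x. u s x - u t x)) \<longlongrightarrow> 0) (at t within J) \<longleftrightarrow>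
      ((\<lambda>s. cls (u s)) \<longlongrightarrow> cls (u t)) (at t within J)"
    if el: "\<forall>t\<in>J. u t \<in> elements E" and t: "t \<in> J" for t
  proof -
    have "((\<lambda>s. norm_in E (\<lambda>x. u s x - u t x)) \<longlongrightarrow> 0) (at t within J) \<longleftrightarrow>
        ((\<lambda>s. norm (cls (u s) - cls (u t))) \<longlongrightarrow> 0) (at t within J)"
      using el t by (intro filterlim_cong)
        (auto simp: eventually_at_filter norm_in_eq_norm_cls elements_diff cls_diff_elements[where E=E]
          intro!: always_eventually)
    also have "\<dots> \<longleftrightarrow> ((\<lambda>s. cls (u s)) \<longlongrightarrow> cls (u t)) (at t within J)"
      by (simp add: tendsto_norm_zero_iff LIM_zero_iff)
    finally show ?thesis .
  qed
  then show ?thesis unfolding cont_in_def continuous_on_def by blast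
qed

lemma has_deriv_in_iff:
  fixes u :: "real \<Rightarrow> 'a::euclidean_space \<Rightarrow> real"
  assumes el: "\<And>t. t \<in> J \<Longrightarrow> u t \<in> elements E" and t: "t \<in> J" and w: "w \<in> elements E"
  shows "has_deriv_in E J u w t \<longleftrightarrow> ((\<lambda>t. cls (u t)) has_vector_derivative cls w) (at t within J)"
proof -
  have eq: "norm_in E (\<lambda>x. (u s x - u t x) / (s - t) - w x) =
      norm (cls (u s) - cls (u t) - (s - t) *\<^sub>R cls w) / norm (s - t)" if s: "s \<in> J" "s \<noteq> t" for s
  proof -
    have d: "(\<lambda>x. u s x - u t x) \<in> elements E" using el s t by (intro elements_diff) auto
    then have q: "(\<lambda>x. inverse (s - t) * (u s x - u t x)) \<in> elements E" by (rule elements_cmult)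
    have "norm_in E (\<lambda>x. inverse (s - t) * (u s x - u t x) - w x) =
        norm (inverse (s - t) *\<^sub>R (cls (u s) - cls (u t)) - cls w)"
      using norm_in_eq_norm_cls[OF elements_diff[OF q w]] cls_diff_elements[OF q w]
        cls_cmult[OF elements_Linf[OF d]]
        cls_diff_elements[OF el[OF s(1)] el[OF t]] by simp
    also have "inverse (s - t) *\<^sub>R (cls (u s) - cls (u t)) - cls w =
        inverse (s - t) *\<^sub>R (cls (u s) - cls (u t) - (s - t) *\<^sub>R cls w)"
      using s by (simp add: scaleR_diff_right)
    finally show ?thesis by (simp add: divide_inverse mult.commute)
  qed
  have "has_deriv_in E J u w t \<longleftrightarrow>
      ((\<lambda>s. norm (cls (u s) - cls (u t) - (s - t) *\<^sub>R cls w) / norm (s - t)) \<longlongrightarrow> 0) (at t within J)"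
    unfolding has_deriv_in_def
    by (intro filterlim_cong refl) (auto simp: eventually_at_filter eq intro!: always_eventually)
  then show ?thesis
    unfolding has_vector_derivative_def has_derivative_iff_norm by (simp add: bounded_linear_scaleR_left)
qed

theorem theorem2p2:
  fixes E :: fspace
    and m varkappa \<kappa> :: real
    and a u0 :: "real ^ 'd \<Rightarrow> real"
    and G :: "(real ^ 'd \<Rightarrow> real) \<Rightarrow> (real ^ 'd \<Rightarrow> real)"
  assumes "m > 0" and "varkappa > 0"
    and "integrable lebesgue a" and "AE x in lebesgue. 0 \<le> a x" and "(LINT x|lebesgue. a x) = 1"
    and G_maps: "\<And>v. v \<in> elements E \<Longrightarrow> G v \<in> elements E"
    and G_well_defined: "\<And>v w. v \<in> elements E \<Longrightarrow> w \<in> elements E \<Longrightarrow> eq_in E v w \<Longrightarrow> eq_in E (G v) (G w)"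
    and G_nonneg: "\<And>v. v \<in> elements E \<Longrightarrow> le_in E (\<lambda>x. 0) v \<Longrightarrow> le_in E (\<lambda>x. 0) (G v)"
    and "\<kappa> > 0"
    and G_Lipschitz: "\<And>r v w. r > 0 \<Longrightarrow> v \<in> tube E r \<Longrightarrow> w \<in> tube E r \<Longrightarrow>
           norm_in E (\<lambda>x. G v x - G w x) \<le> exp (\<kappa> * r) * norm_in E (\<lambda>x. v x - w x)"
    and "u0 \<in> elements E" and "le_in E (\<lambda>x. 0) u0"
  shows "(\<forall>T>0. \<exists>u. nonneg_classical_solution E varkappa m a G u0 {0..T} u \<and>
             (\<forall>v. nonneg_classical_solution E varkappa m a G u0 {0..T} v \<longrightarrow>
                (\<forall>t\<in>{0..T}. eq_in E (v t) (u t)))) \<and>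
         (\<exists>u. nonneg_classical_solution E varkappa m a G u0 {0..} u \<and>
             (\<forall>T>0. nonneg_classical_solution E varkappa m a G u0 {0..T} u \<and>
                (\<forall>v. nonneg_classical_solution E varkappa m a G u0 {0..T} v \<longrightarrow>
                   (\<forall>t\<in>{0..T}. eq_in E (v t) (u t)))))"
proof -
  interpret probability_kernel a by unfold_locales fact+
  \<comment> \<open>\<open>G\<close> respects equality in \<open>E\<close>, so it acts on classes.\<close>
  define G' where "G' V = cls (G (representative E V))" for V
  have G'_cls: "G' (cls v) = cls (G v)" if v: "v \<in> elements E" for v
  proof -
    note rep = representative[OF cls_in_classes[OF v]]
    have "eq_in E (representative E (cls v)) v" using eq_in_iff_cls[OF rep(1) v] rep(2) by simp
    then have "eq_in E (G (representative E (cls v))) (G v)" by (rule G_well_defined[OF rep(1) v])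
    then show ?thesis unfolding G'_def using eq_in_iff_cls[OF G_maps G_maps] rep(1) v by blast
  qed
  interpret abstract_logistic "classes E" "class_convolution a" G' varkappa m \<kappa>
  proof (rule abstract_logistic.intro)
    show "subspace (classes E :: (real ^ 'd) linf set)" by (rule subspace_classes)
    show "closed (classes E :: (real ^ 'd) linf set)" by (rule closed_classes)
    show "linear (class_convolution a)" by (rule linear_class_convolution)
    show "class_convolution a 1 = 1" by (rule class_convolution_one)
    show "0 \<le> varkappa" "0 \<le> m" using \<open>varkappa > 0\<close> \<open>m > 0\<close> by auto
    show "V * W \<in> classes E" if "V \<in> classes E" "W \<in> classes E" for V W :: "(real ^ 'd) linf"
      using that by (rule classes_mult)
    show "V * W \<in> order_interval (r * s)"
      if "V \<in> order_interval r" "W \<in> order_interval s" for V W :: "(real ^ 'd) linf" and r s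
      using that by (rule order_interval_mult)
    show "norm (class_convolution a V) \<le> norm V" for V by (rule norm_class_convolution)
    show "class_convolution a V \<in> classes E" if "V \<in> classes E" for V
      using that by (rule class_convolution_in_classes)
    show "G' V \<in> classes E" if "V \<in> classes E" for V
      unfolding G'_def using representative(1)[OF that] by (intro cls_in_classes G_maps)
    show "G' V \<in> order_interval (norm (G' V))" if "V \<in> classes E" "V \<in> order_interval r" for V r
    proof -
      obtain v where v: "v \<in> elements E" "V = cls v" using \<open>V \<in> classes E\<close> by (rule classesE)
      have "le_in E (\<lambda>x. 0) v" using that(2) tube_iff_cls[OF v(1), of r] v(2) by (simp add: tube_def)
      then have "le_in E (\<lambda>x. 0) (G v)" by (rule G_nonneg[OF v(1)])
      then show ?thesis
        using nonneg_iff_cls[OF G_maps[OF v(1)] order_refl] G'_cls[OF v(1)] v(2) by simp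
    qed
    show "norm (G' V - G' W) \<le> exp (\<kappa> * r) * norm (V - W)"
      if "0 < r" and V: "V \<in> classes E \<inter> order_interval r" and W: "W \<in> classes E \<inter> order_interval r"
      for V W r
    proof -
      obtain v where v: "v \<in> elements E" "V = cls v" using V by (auto elim: classesE)
      obtain w where w: "w \<in> elements E" "W = cls w" using W by (auto elim: classesE)
      have "v \<in> tube E r" "w \<in> tube E r"
        using V W v w tube_iff_cls[OF v(1)] tube_iff_cls[OF w(1)] by auto
      from G_Lipschitz[OF \<open>0 < r\<close> this] show ?thesis
        using v w by (simp add: norm_in_eq_norm_cls elements_diff G_maps cls_diff_elements[where E=E] G'_cls)
    qed
  qed
  have cls_rhs: "(\<lambda>x. varkappa * convolution a v x - m * v x - v x * G v x) \<in> elements E"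
      "cls (\<lambda>x. varkappa * convolution a v x - m * v x - v x * G v x) = rhs (cls v)"
    if v: "v \<in> elements E" for v
  proof -
    note el = v G_maps[OF v] convolution_elements[OF v]
    show "(\<lambda>x. varkappa * convolution a v x - m * v x - v x * G v x) \<in> elements E"
      using el by (intro elements_diff elements_cmult elements_mult)
    show "cls (\<lambda>x. varkappa * convolution a v x - m * v x - v x * G v x) = rhs (cls v)"
      unfolding rhs_def using el[THEN elements_Linf]
      by (simp add: cls_diff cls_cmult cls_mult class_convolution_cls G'_cls v
          Linf_diff Linf_cmult Linf_mult)
  qed
  \<comment> \<open>The summand 1 makes \<open>c\<close> positive if the initial value vanishes.\<close>
  define c where "c = norm (cls u0) + 1"
  have "0 < c" by (simp add: c_def add_nonneg_pos)
  have "cls u0 \<in> classes E \<inter> order_interval c"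
    using nonneg_iff_cls[OF \<open>u0 \<in> elements E\<close>, of c] \<open>le_in E (\<lambda>x. 0) u0\<close> cls_in_classes[OF \<open>u0 \<in> elements E\<close>]
    by (simp add: c_def)
  then obtain U where U0: "U 0 = cls u0"
    and U_mem: "\<And>t T. 0 \<le> t \<Longrightarrow> t \<le> T \<Longrightarrow> U t \<in> classes E \<inter> order_interval (c * exp (varkappa * T))"
    and U_deriv: "\<And>t. 0 \<le> t \<Longrightarrow> (U has_vector_derivative rhs (U t)) (at t within {0..})"
    and U_rhs: "continuous_on {0..} (\<lambda>t. rhs (U t))"
    using solution_exists_global[OF _ \<open>0 < c\<close>] by metis
  have U_cont: "continuous_on {0..} U"
    unfolding continuous_on_eq_continuous_within
    using has_vector_derivative_continuous[OF U_deriv] by simp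
  define u where "u t = representative E (U t)" for t
  define u' where "u' t = representative E (rhs (U t))" for t
  have u: "u t \<in> elements E" "cls (u t) = U t" if "0 \<le> t" for t
    using representative[of "U t" E] U_mem[of t t] that by (auto simp: u_def)
  have u': "u' t \<in> elements E" "cls (u' t) = rhs (U t)" if "0 \<le> t" for t
    using representative[OF rhs_X, of "U t"] U_mem[of t t] that by (auto simp: u'_def)
  have solution: "nonneg_classical_solution E varkappa m a G u0 I u" if I: "I \<subseteq> {0..}" for I
    unfolding nonneg_classical_solution_def classical_solution_def C1_in_def
  proof (intro conjI exI ballI)
    have pos: "0 \<le> t" if "t \<in> J" "J \<subseteq> I" for t J using that I by auto
    have cont: "cont_in E J u" "cont_in E J u'" if J: "J \<subseteq> I" for J
    proof -
      have "continuous_on J (\<lambda>t. cls (u t))" "continuous_on J (\<lambda>t. cls (u' t))"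
        using continuous_on_subset[OF U_cont, of J] continuous_on_subset[OF U_rhs, of J] I J
        by (auto simp: u u' pos[OF _ J] cong: continuous_on_cong)
      then show "cont_in E J u" "cont_in E J u'"
        using u u' pos[OF _ J] by (auto simp: cont_in_iff)
    qed
    show "cont_in E I u" "cont_in E (I - {0}) u" "cont_in E (I - {0}) u'" by (auto intro: cont)
    show "eq_in E (u 0) u0"
      using eq_in_iff_cls[OF u(1) \<open>u0 \<in> elements E\<close>, of 0] u(2)[of 0] U0 by simp
    fix t assume "t \<in> I - {0}"
    then have t: "0 \<le> t" using I by auto
    have "((\<lambda>t. cls (u t)) has_vector_derivative cls (u' t)) (at t within I - {0})"
    proof (rule has_vector_derivative_transform)
      show "t \<in> I - {0}" by fact
      show "(U has_vector_derivative cls (u' t)) (at t within I - {0})"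
        unfolding u'(2)[OF t] using I by (intro has_vector_derivative_within_subset[OF U_deriv[OF t]]) auto
      show "cls (u s) = U s" if "s \<in> I - {0}" for s using that I by (intro u) auto
    qed
    then show "has_deriv_in E (I - {0}) u (u' t) t"
      using I \<open>t \<in> I - {0}\<close> by (subst has_deriv_in_iff) (auto intro: u u' t)
    show "eq_in E (u' t) (\<lambda>x. varkappa * convolution a (u t) x - m * u t x - u t x * G (u t) x)"
      using eq_in_iff_cls[OF u'(1)[OF t] cls_rhs(1)[OF u(1)[OF t]]] cls_rhs(2)[OF u(1)[OF t]] u u' t
      by simp
  next
    fix t assume "t \<in> I"
    then have t: "0 \<le> t" using I by auto
    then have "u t \<in> tube E (c * exp (varkappa * t))"
      using tube_iff_cls[OF u(1)[OF t]] u(2) U_mem[of t t] by simp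
    then show "le_in E (\<lambda>x. 0) (u t)" by (simp add: tube_def)
  qed
  have unique: "eq_in E (v t) (u t)"
    if v: "nonneg_classical_solution E varkappa m a G u0 {0..T} v" and t: "t \<in> {0..T}" for T v t
  proof -
    let ?V = "\<lambda>t. cls (v t)"
    have I: "{0..T} - {0} = {0<..T}" by auto
    obtain v' where v_cont: "cont_in E {0..T} v" and v': "cont_in E {0<..T} v'"
      and v_deriv: "\<And>t. t \<in> {0<..T} \<Longrightarrow> has_deriv_in E {0<..T} v (v' t) t"
      and v_eq: "\<And>t. t \<in> {0<..T} \<Longrightarrow>
        eq_in E (v' t) (\<lambda>x. varkappa * convolution a (v t) x - m * v t x - v t x * G (v t) x)"
      and v0: "eq_in E (v 0) u0" and v_nonneg: "\<And>t. t \<in> {0..T} \<Longrightarrow> le_in E (\<lambda>x. 0) (v t)"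
      using v unfolding nonneg_classical_solution_def classical_solution_def C1_in_def I by blast
    have v_el: "v t \<in> elements E" if "t \<in> {0..T}" for t using v_cont that by (simp add: cont_in_iff)
    have V_cont: "continuous_on {0..T} ?V" using v_cont by (simp add: cont_in_iff)
    then have "bounded (?V ` {0..T})"
      using compact_continuous_image compact_imp_bounded compact_Icc by blast
    then obtain B where "\<forall>y\<in>?V ` {0..T}. norm y \<le> B" unfolding bounded_iff ..
    then have B: "norm (?V t) \<le> B" if "t \<in> {0..T}" for t using that by blast
    \<comment> \<open>Both solutions lie in one order interval, where the right-hand side is Lipschitz.\<close>
    define r where "r = max B (c * exp (varkappa * T))"
    have "?V t = U t"
    proof (rule solution_unique[where T=T and r=r])
      show "0 < r" using \<open>0 < c\<close> by (simp add: r_def less_max_iff_disj)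
      show "?V s \<in> classes E \<inter> order_interval r" if "s \<in> {0..T}" for s
        using nonneg_iff_cls[OF v_el[OF that], of r] B[OF that] v_nonneg[OF that] cls_in_classes[OF v_el[OF that]]
        by (simp add: r_def)
      show "U s \<in> classes E \<inter> order_interval r" if "s \<in> {0..T}" for s
        using U_mem[of s T] that order_interval_mono[of "U s" "c * exp (varkappa * T)" r] by (simp add: r_def)
      show "continuous_on {0..T} U" using U_cont by (rule continuous_on_subset) auto
      show "(U has_vector_derivative rhs (U s)) (at s within {0<..T})" if "s \<in> {0<..T}" for s
        using that by (intro has_vector_derivative_within_subset[OF U_deriv]) auto
      show "(?V has_vector_derivative rhs (?V s)) (at s within {0<..T})" if s: "s \<in> {0<..T}" for s
      proof -
        have s': "s \<in> {0..T}" using s by simp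
        have v's: "v' s \<in> elements E" using v' s by (simp add: cont_in_iff)
        have "cls (v' s) = rhs (?V s)"
          using v_eq[OF s] eq_in_iff_cls[OF v's cls_rhs(1)[OF v_el[OF s']]] cls_rhs(2)[OF v_el[OF s']] by simp
        moreover have "(?V has_vector_derivative cls (v' s)) (at s within {0<..T})"
          using v_deriv[OF s] has_deriv_in_iff[of "{0<..T}" v E s "v' s"] v_el s v's by simp
        ultimately show ?thesis by simp
      qed
      have "0 \<in> {0..T}" using t by simp
      then show "?V 0 = U 0" using v0 eq_in_iff_cls[OF v_el \<open>u0 \<in> elements E\<close>] U0 by simp
    qed (use V_cont t in auto)
    then show ?thesis using eq_in_iff_cls[OF v_el[OF t] u(1)] u(2) t by simp
  qed
  have "nonneg_classical_solution E varkappa m a G u0 {0..T} u" for T by (rule solution) auto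
  moreover have "nonneg_classical_solution E varkappa m a G u0 {0..} u" by (rule solution) auto
  ultimately show ?thesis using unique by blast
qed

end
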